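(* Let $r\geq 2$ and $k\geq 1$ be integers. For all integers $n\geq rk$, $\chi\big(C_{\mathrm{Hom}_p(\mathcal{K}_r, KG(n,k))}\big)\geq n-r(k-1)$.
   Context: All graphs are finite, simple and undirected; $\mathcal{K}_r$ denotes the complete graph on vertex set $\{1,\dots,r\}$ and $\chi$ denotes chromatic number. The Kneser graph $KG(n,k)$ has as vertices the $k$-element subsets of $\{1,\dots,n\}$, two being adjacent iff they are disjoint. For a graph $H$, the Hom poset $\mathrm{Hom}_p(\mathcal{K}_r,H)$ is the set of all $r$-tuples $(A_1,\dots,A_r)$ of non-empty subsets of $V(H)$ such that for every pair $i\neq j$ in $\{1,\dots,r\}$, $A_i\times A_j\subseteq E(H)$, ordered componentwise by inclusion. The cyclic group $Z_r=\{e=\omega^0,\dots,\omega^{r-1}\}$ acts on it by cyclic shift: $\omega^i.(A_1,\dots,A_r)=(A_{1+i},\dots,A_{r+i})$, indices modulo $r$ in $\{1,\dots,r\}$. For a poset $P$ with an order-preserving action of a finite group $G$, the compatibility graph $C_P$ has vertex set $P$, with $x,y$ adjacent iff there is $g\in G\setminus\{e\}$ such that $x$ and $g.y$ are comparable in $P$. *)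

theory Defs
  imports
    "Graph_Theory.Pair_Digraph"
    "HOL-Algebra.Group_Action"
    "HOL-Algebra.Order"
    "HOL-Algebra.Elementary_Groups"
begin

text \<open>Graphs are records of type \<^typ>\<open>'a pair_pre_digraph\<close>; an undirected edge is represented by both
  of its orientations. A finite simple undirected graph is one satisfying \<^const>\<open>pair_graph\<close>.\<close>

definition proper_colouring :: "'a pair_pre_digraph \<Rightarrow> nat \<Rightarrow> ('a \<Rightarrow> nat) \<Rightarrow> bool" where
  "proper_colouring G c f \<longleftrightarrow> f \<in> pverts G \<rightarrow> {..<c} \<and> (\<forall>(u, v) \<in> parcs G. f u \<noteq> f v)"

text \<open>The set below is non-empty for every finite loopfree graph, see \<open>ex_proper_colouring\<close>.\<close>

definition chromatic_number :: "'a pair_pre_digraph \<Rightarrow> nat" where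
  "chromatic_number G = (LEAST c. \<exists>f. proper_colouring G c f)"

definition kneser_graph :: "nat \<Rightarrow> nat \<Rightarrow> nat set pair_pre_digraph" where
  "kneser_graph n k =
    (let V = {A. A \<subseteq> {1..n} \<and> card A = k}
     in \<lparr>pverts = V, parcs = {(A, B). A \<in> V \<and> B \<in> V \<and> A \<inter> B = {}}\<rparr>)"

text \<open>An \<open>r\<close>-tuple is an extensional function on \<open>{1..r}\<close>.\<close>

definition hom_poset :: "nat \<Rightarrow> 'a pair_pre_digraph \<Rightarrow> (nat \<Rightarrow> 'a set) gorder" where
  "hom_poset r H =
    \<lparr>carrier = {A \<in> {1..r} \<rightarrow>\<^sub>E {X. X \<subseteq> pverts H \<and> X \<noteq> {}}.
                  \<forall>i\<in>{1..r}. \<forall>j\<in>{1..r}. i \<noteq> j \<longrightarrow> A i \<times> A j \<subseteq> parcs H},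
     eq = (=),
     le = (\<lambda>A B. \<forall>i\<in>{1..r}. A i \<subseteq> B i)\<rparr>"

text \<open>The element \<open>\<omega>\<^sup>i\<close> of \<open>Z\<^sub>r\<close> is the element \<open>i\<close> of the additive group \<^term>\<open>integer_mod_group r\<close>.
  The index \<open>j + i\<close> is reduced modulo \<open>r\<close> to a representative in \<open>{1..r}\<close>.\<close>

definition cyclic_shift ::
    "nat \<Rightarrow> 'a pair_pre_digraph \<Rightarrow> int \<Rightarrow> (nat \<Rightarrow> 'a set) \<Rightarrow> nat \<Rightarrow> 'a set" where
  "cyclic_shift r H i =
    (\<lambda>A\<in>carrier (hom_poset r H). \<lambda>j\<in>{1..r}. A (nat ((int j + i - 1) mod int r) + 1))"

definition compatibility_graph ::
    "('g, 'c) monoid_scheme \<Rightarrow> ('g \<Rightarrow> 'p \<Rightarrow> 'p) \<Rightarrow> 'p gorder \<Rightarrow> 'p pair_pre_digraph" where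
  "compatibility_graph G \<phi> P =
    \<lparr>pverts = carrier P,
     parcs = {(x, y). x \<in> carrier P \<and> y \<in> carrier P \<and>
       (\<exists>g \<in> carrier G - {\<one>\<^bsub>G\<^esub>}. x \<sqsubseteq>\<^bsub>P\<^esub> \<phi> g y \<or> \<phi> g y \<sqsubseteq>\<^bsub>P\<^esub> x)}\<rparr>"

lemma ex_proper_colouring:
  assumes "pair_digraph G"
  shows "\<exists>c f. proper_colouring G c f"
proof -
  interpret pair_digraph G by fact
  obtain f :: "'a \<Rightarrow> nat" and c where "f ` pverts G = {i. i < c}" "inj_on f (pverts G)"
    using finite_imp_inj_to_nat_seg[OF pair_finite_verts] by blast
  then have "proper_colouring G c f"
    using in_arcsD1 in_arcsD2 pair_no_loops[of "(u, v)" for u v]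
    by (auto simp: proper_colouring_def inj_on_eq_iff)
  then show ?thesis by blast
qed

lemma pair_graph_kneser_graph:
  assumes "k \<ge> 1"
  shows "pair_graph (kneser_graph n k)"
proof -
  let ?K = "kneser_graph n k"
  have verts: "A \<in> pverts ?K \<longleftrightarrow> A \<subseteq> {1..n} \<and> card A = k" for A
    by (simp add: kneser_graph_def)
  have arcs: "(A, B) \<in> parcs ?K \<longleftrightarrow> A \<in> pverts ?K \<and> B \<in> pverts ?K \<and> A \<inter> B = {}" for A B
    by (simp add: kneser_graph_def)
  have fin: "finite (pverts ?K)"
    by (rule finite_subset[of _ "Pow {1..n}"]) (use verts in blast, simp)
  have fin_arcs: "finite (parcs ?K)"
    by (rule finite_subset[of _ "pverts ?K \<times> pverts ?K"]) (use fin in \<open>auto simp: arcs\<close>)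
  have sym: "sym (parcs ?K)"
    by (rule symI) (auto simp: arcs)
  show ?thesis
  proof
    fix e assume "e \<in> parcs ?K"
    then obtain A B where e: "e = (A, B)" and AB: "(A, B) \<in> parcs ?K" by (cases e) blast
    then show "fst e \<in> pverts ?K" "snd e \<in> pverts ?K" by (simp_all add: arcs)
    have "A \<noteq> {}" using AB assms unfolding arcs verts by force
    then show "fst e \<noteq> snd e" using AB unfolding arcs e by auto
  next
    show "symmetric (with_proj ?K)" using sym by (simp add: symmetric_def)
  qed (use fin fin_arcs in auto)
qed

lemma partial_order_hom_poset: "partial_order (hom_poset r H)"
proof -
  have antisym: "A = B" if "A \<sqsubseteq>\<^bsub>hom_poset r H\<^esub> B" "B \<sqsubseteq>\<^bsub>hom_poset r H\<^esub> A"
    "A \<in> carrier (hom_poset r H)" "B \<in> carrier (hom_poset r H)" for A B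
  proof (rule PiE_ext)
    show "A \<in> {1..r} \<rightarrow>\<^sub>E {X. X \<subseteq> pverts H \<and> X \<noteq> {}}" "B \<in> {1..r} \<rightarrow>\<^sub>E {X. X \<subseteq> pverts H \<and> X \<noteq> {}}"
      using that(3,4) by (simp_all add: hom_poset_def)
    show "A i = B i" if "i \<in> {1..r}" for i
      using \<open>A \<sqsubseteq>\<^bsub>hom_poset r H\<^esub> B\<close> \<open>B \<sqsubseteq>\<^bsub>hom_poset r H\<^esub> A\<close> that by (auto simp: hom_poset_def)
  qed
  have eq: "(.=\<^bsub>hom_poset r H\<^esub>) = (=)" by (simp add: hom_poset_def)
  have le: "A \<sqsubseteq>\<^bsub>hom_poset r H\<^esub> B \<longleftrightarrow> (\<forall>i\<in>{1..r}. A i \<subseteq> B i)" for A B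
    by (simp add: hom_poset_def)
  show ?thesis
  proof
    show "A \<sqsubseteq>\<^bsub>hom_poset r H\<^esub> C" if "A \<sqsubseteq>\<^bsub>hom_poset r H\<^esub> B" "B \<sqsubseteq>\<^bsub>hom_poset r H\<^esub> C" for A B C
      using that unfolding le by blast
  qed (use antisym in \<open>auto simp: eq le\<close>)
qed

lemma cyclic_shift_index:
  assumes "r \<ge> 1"
  shows "nat (i mod int r) + 1 \<in> {1..r}"
proof -
  have "0 \<le> i mod int r" "i mod int r < int r" using assms by simp_all
  then show ?thesis by auto
qed

lemma cyclic_shift_closed:
  assumes "r \<ge> 1" "A \<in> carrier (hom_poset r H)"
  shows "cyclic_shift r H i A \<in> carrier (hom_poset r H)"
proof -
  let ?s = "\<lambda>j. nat ((int j + i - 1) mod int r) + 1"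
  have s: "?s j \<in> {1..r}" for j
    by (rule cyclic_shift_index[OF assms(1)])
  have inj: "j = j'" if "?s j = ?s j'" "j \<in> {1..r}" "j' \<in> {1..r}" for j j'
  proof -
    have "(int j + i - 1) mod int r = (int j' + i - 1) mod int r"
      using that(1) assms(1) by (simp add: eq_nat_nat_iff)
    then have "int r dvd int j - int j'"
      by (simp add: mod_eq_dvd_iff algebra_simps)
    moreover have "\<bar>int j - int j'\<bar> < int r" using that by auto
    ultimately have "int j - int j' = 0"
      using dvd_imp_le_int[of "int j - int j'" "int r"] by linarith
    then show ?thesis by simp
  qed
  have A: "A \<in> {1..r} \<rightarrow>\<^sub>E {X. X \<subseteq> pverts H \<and> X \<noteq> {}}"
    "\<And>i j. i \<in> {1..r} \<Longrightarrow> j \<in> {1..r} \<Longrightarrow> i \<noteq> j \<Longrightarrow> A i \<times> A j \<subseteq> parcs H"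
    using assms(2) by (auto simp: hom_poset_def)
  have eq: "cyclic_shift r H i A = (\<lambda>j\<in>{1..r}. A (?s j))"
    using assms(2) by (simp add: cyclic_shift_def)
  have 1: "(\<lambda>j\<in>{1..r}. A (?s j)) \<in> {1..r} \<rightarrow>\<^sub>E {X. X \<subseteq> pverts H \<and> X \<noteq> {}}"
    using PiE_mem[OF A(1) s] by (simp add: restrict_PiE_iff)
  have 2: "A (?s j) \<times> A (?s j') \<subseteq> parcs H"
    if "j \<in> {1..r}" "j' \<in> {1..r}" "j \<noteq> j'" for j j'
    by (rule A(2)[OF s s]) (use inj that in blast)
  show ?thesis unfolding eq using 1 2 by (simp add: hom_poset_def)
qed

lemma cyclic_shift_add:
  assumes "r \<ge> 1" "A \<in> carrier (hom_poset r H)"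
  shows "cyclic_shift r H i (cyclic_shift r H j A) = cyclic_shift r H ((i + j) mod int r) A"
proof
  fix l
  have *: "nat ((int l + i - 1) mod int r) + 1 \<in> {1..r}"
    by (rule cyclic_shift_index[OF assms(1)])
  have "(int (nat ((int l + i - 1) mod int r) + 1) + j - 1) mod int r
      = (int l + (i + j) mod int r - 1) mod int r"
  proof -
    have "(int (nat ((int l + i - 1) mod int r) + 1) + j - 1) mod int r
        = ((int l + i - 1) mod int r + j) mod int r" using assms(1) by simp
    also have "\<dots> = (int l - 1 + (i + j)) mod int r" by (simp add: mod_simps algebra_simps)
    also have "\<dots> = (int l - 1 + (i + j) mod int r) mod int r" by (simp add: mod_simps)
    finally show ?thesis by (simp add: algebra_simps)
  qed
  then show "cyclic_shift r H i (cyclic_shift r H j A) l = cyclic_shift r H ((i + j) mod int r) A l"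
    using * cyclic_shift_closed[OF assms, of j] assms(2)
    by (simp add: cyclic_shift_def)
qed

lemma cyclic_shift_0:
  assumes "A \<in> carrier (hom_poset r H)"
  shows "cyclic_shift r H 0 A = A"
proof
  fix l
  have A: "A \<in> {1..r} \<rightarrow>\<^sub>E {X. X \<subseteq> pverts H \<and> X \<noteq> {}}"
    using assms by (auto simp: hom_poset_def)
  show "cyclic_shift r H 0 A l = A l"
  proof (cases "l \<in> {1..r}")
    case True
    then have "(int l + 0 - 1) mod int r = int l - 1" by simp
    moreover have "nat (int l - 1) + 1 = l" using True by auto
    ultimately have "nat ((int l + 0 - 1) mod int r) + 1 = l" by metis
    then have "A (nat ((int l + 0 - 1) mod int r) + 1) = A l" by (rule arg_cong)
    then show ?thesis using True assms unfolding cyclic_shift_def by (simp del: add_0_right)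
  next
    case False
    then show ?thesis using assms PiE_arb[OF A False] unfolding cyclic_shift_def restrict_def by (simp del: atLeastAtMost_iff)
  qed
qed

lemma group_action_cyclic_shift:
  assumes "r \<ge> 1"
  shows "group_action (integer_mod_group r) (carrier (hom_poset r H)) (cyclic_shift r H)"
proof -
  let ?E = "carrier (hom_poset r H)" and ?c = "cyclic_shift r H"
  have ext: "?c i \<in> extensional ?E" for i by (simp add: cyclic_shift_def)
  have mod0: "?c i (?c (- i) A) = A" "?c (- i) (?c i A) = A" if "A \<in> ?E" for i A
    using cyclic_shift_add[OF assms that] cyclic_shift_0[OF that] by simp_all
  have "bij_betw (?c i) ?E ?E" for i
    by (rule bij_betw_byWitness[where f' = "?c (- i)"])
      (use mod0 cyclic_shift_closed[OF assms] in auto)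
  then have Bij: "?c i \<in> Bij ?E" for i using ext by (simp add: Bij_def)
  have "?c ((i + j) mod int r) = compose ?E (?c i) (?c j)" for i j
    by (rule extensionalityI[OF ext]) (auto simp: compose_def cyclic_shift_add[OF assms])
  then have "?c \<in> hom (integer_mod_group r) (BijGroup ?E)"
    using Bij by (simp add: hom_def BijGroup_def)
  then show ?thesis
    by (simp add: group_action_def group_hom_def group_hom_axioms_def group_BijGroup)
qed

lemma cyclic_shift_mono:
  assumes "r \<ge> 1" "A \<in> carrier (hom_poset r H)" "B \<in> carrier (hom_poset r H)"
    "A \<sqsubseteq>\<^bsub>hom_poset r H\<^esub> B"
  shows "cyclic_shift r H i A \<sqsubseteq>\<^bsub>hom_poset r H\<^esub> cyclic_shift r H i B"
proof -
  have "nat ((int j + i - 1) mod int r) + 1 \<in> {1..r}" for j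
    by (rule cyclic_shift_index[OF assms(1)])
  then have "A (nat ((int j + i - 1) mod int r) + 1) \<subseteq> B (nat ((int j + i - 1) mod int r) + 1)" for j
    using assms(4) by (simp add: hom_poset_def)
  then show ?thesis using assms(2,3) by (simp add: hom_poset_def cyclic_shift_def)
qed

lemma pair_graph_compatibility_graph_hom_poset:
  assumes "r \<ge> 1" "pair_graph H"
  shows "pair_graph (compatibility_graph (integer_mod_group r) (cyclic_shift r H) (hom_poset r H))"
    (is "pair_graph ?C")
proof -
  interpret H: pair_graph H by fact
  let ?P = "hom_poset r H" and ?Z = "integer_mod_group r" and ?c = "cyclic_shift r H"
  have arcs: "(x, y) \<in> parcs ?C \<longleftrightarrow> x \<in> carrier ?P \<and> y \<in> carrier ?P \<and>
      (\<exists>i\<in>{0..<int r} - {0}. x \<sqsubseteq>\<^bsub>?P\<^esub> ?c i y \<or> ?c i y \<sqsubseteq>\<^bsub>?P\<^esub> x)" for x y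
    using assms(1) by (simp add: compatibility_graph_def carrier_integer_mod_group)
  have verts: "pverts ?C = carrier ?P" by (simp add: compatibility_graph_def)
  have "finite ({1..r} \<rightarrow>\<^sub>E {X. X \<subseteq> pverts H \<and> X \<noteq> {}})"
    using H.pair_finite_verts by (intro finite_PiE) auto
  then have fin: "finite (carrier ?P)"
    by (rule finite_subset[rotated]) (auto simp: hom_poset_def)
  have fin_arcs: "finite (parcs ?C)"
    by (rule finite_subset[of _ "carrier ?P \<times> carrier ?P"])
      (use fin in \<open>auto simp: arcs\<close>)
  have noloop: False
    if A: "A \<in> carrier ?P" and i: "i \<in> {0..<int r}" "i \<noteq> 0"
      and le: "A \<sqsubseteq>\<^bsub>?P\<^esub> ?c i A \<or> ?c i A \<sqsubseteq>\<^bsub>?P\<^esub> A" for A i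
  proof -
    have m: "(int 1 + i - 1) mod int r = i" using i by simp
    have j: "nat i + 1 \<in> {1..r}" "nat i + 1 \<noteq> 1" "1 \<in> {1..r}" using i by auto
    have c: "?c i A 1 = A (nat i + 1)" using A j m by (simp add: cyclic_shift_def)
    have "A 1 \<subseteq> A (nat i + 1) \<or> A (nat i + 1) \<subseteq> A 1"
      using le j(3) unfolding c[symmetric] by (auto simp: hom_poset_def)
    moreover have AE: "A \<in> {1..r} \<rightarrow>\<^sub>E {X. X \<subseteq> pverts H \<and> X \<noteq> {}}" and
      "A 1 \<times> A (nat i + 1) \<subseteq> parcs H"
      using A j by (auto simp: hom_poset_def)
    moreover have "A 1 \<noteq> {}" "A (nat i + 1) \<noteq> {}" using PiE_mem[OF AE] j by auto
    ultimately obtain v where "(v, v) \<in> parcs H" by blast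
    then show False using H.pair_no_loops by force
  qed
  have "(y, x) \<in> parcs ?C" if xy: "(x, y) \<in> parcs ?C" for x y
  proof -
    obtain i where i: "i \<in> {0..<int r}" "i \<noteq> 0" and x: "x \<in> carrier ?P" and y: "y \<in> carrier ?P"
      and le: "x \<sqsubseteq>\<^bsub>?P\<^esub> ?c i y \<or> ?c i y \<sqsubseteq>\<^bsub>?P\<^esub> x"
      using xy unfolding arcs by blast
    have inv: "?c (int r - i) (?c i y) = y"
      using cyclic_shift_add[OF assms(1) y] cyclic_shift_0[OF y] by simp
    have "?c (int r - i) x \<sqsubseteq>\<^bsub>?P\<^esub> y \<or> y \<sqsubseteq>\<^bsub>?P\<^esub> ?c (int r - i) x"
      using le cyclic_shift_mono[OF assms(1)] x y cyclic_shift_closed[OF assms(1) y] inv by metis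
    moreover have "int r - i \<in> {0..<int r}" "int r - i \<noteq> 0" using i by auto
    ultimately show ?thesis using x y unfolding arcs by blast
  qed
  then have sym: "sym (parcs ?C)" by (blast intro: symI)
  show ?thesis
  proof
    fix e assume e: "e \<in> parcs ?C"
    then obtain x y where xy: "e = (x, y)" "(x, y) \<in> parcs ?C" by (cases e) blast
    then show "fst e \<in> pverts ?C" "snd e \<in> pverts ?C" by (auto simp: arcs verts)
    show "fst e \<noteq> snd e"
    proof
      assume "fst e = snd e"
      then show False using xy noloop[of x] unfolding arcs by (metis Diff_iff fst_conv insertI1 snd_conv)
    qed
  next
    show "symmetric (with_proj ?C)" using sym by (simp add: symmetric_def)
  qed (use fin fin_arcs verts in auto)
qed

end

theory Submission
  imports Defs
begin

text \<open>
  Replacing the members of a tuple by the unions of their elements relates the Hom poset to the poset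
  \<open>P\<close> of partial colourings of \<open>{1..n}\<close> by \<open>{1..r}\<close> in which every colour is used at
  least \<open>k\<close> times; the natural map from \<open>P\<close> to the Hom poset is monotone and equivariant. Branching
  on the colour of one vertex and applying Mayer--Vietoris shows that the order complex of \<open>P\<close> is
  acyclic over the integers up to dimension \<open>n - rk - 1\<close>. Hence there are chains \<open>z\<^sub>i\<close> with
  \<open>i \<le> d = n - rk\<close>, where \<open>z\<^sub>0\<close> has augmentation 1 and the boundary of \<open>z\<^sub>i\<^sub>+\<^sub>1\<close> is alternately
  \<open>(\<omega> - 1) z\<^sub>i\<close> and the orbit sum of \<open>z\<^sub>i\<close>. A proper colouring of the compatibility graph with
  \<open>m\<close> colours takes \<open>r\<close> different values on every orbit, so the least of them is at most \<open>m - r\<close>; together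
  with the position where it is attained it maps the order complex equivariantly to the
  \<open>(m - r + 1)\<close>-fold join of copies of \<open>Z\<^sub>r\<close>. If \<open>m - r + 1 \<le> d\<close>, then \<open>z\<^sub>d\<close> is mapped to 0, and as
  the chain modules of the join are free over \<open>Z\<^sub>r\<close>, one descends to the conclusion that the augmentation
  of \<open>z\<^sub>0\<close> is divisible by \<open>r\<close>. The group order need not be prime.
\<close>

section \<open>Alternating chains\<close>

definition alternating :: "('a list \<Rightarrow> int) \<Rightarrow> bool" where
  "alternating z \<longleftrightarrow> (\<forall>xs x y ys. z (xs @ x # y # ys) = - z (xs @ y # x # ys))"

text \<open>Oriented chains of the flag complex of \<open>R\<close> on \<open>S\<close>, as alternating functions on lists of
  vertices. The index \<open>l\<close> is the number of vertices of a simplex, so it exceeds the dimension by one, and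
  \<open>l = 0\<close> is the augmentation term of the reduced complex. In this form the boundary needs no signs.\<close>

definition alt_chains :: "('a \<Rightarrow> 'a \<Rightarrow> bool) \<Rightarrow> 'a set \<Rightarrow> nat \<Rightarrow> ('a list \<Rightarrow> int) set" where
  "alt_chains R S l = {z. alternating z \<and>
     (\<forall>L. z L \<noteq> 0 \<longrightarrow> length L = l \<and> set L \<subseteq> S \<and> (\<forall>x\<in>set L. \<forall>y\<in>set L. R x y))}"

text \<open>The usual boundary read on coefficients: the oriented simplex \<open>v # L\<close> has
  \<open>L\<close> as a face with sign plus. \<open>U\<close> is a fixed ambient vertex set, so that
  one operator serves all complexes inside it.\<close>

definition boundary :: "'a set \<Rightarrow> ('a list \<Rightarrow> int) \<Rightarrow> 'a list \<Rightarrow> int" where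
  "boundary U z L = (\<Sum>v\<in>U. z (v # L))"

text \<open>Vanishing of reduced homology up to dimension \<open>l - 1\<close>, as \<open>m\<close>
  counts vertices. The case \<open>m = 0\<close> asks the empty simplex to bound, which forces
  \<open>S\<close> to be non-empty.\<close>

definition acyclic_upto :: "'a set \<Rightarrow> ('a \<Rightarrow> 'a \<Rightarrow> bool) \<Rightarrow> nat \<Rightarrow> 'a set \<Rightarrow> bool" where
  "acyclic_upto U R l S \<longleftrightarrow> (\<forall>m\<le>l. \<forall>z\<in>alt_chains R S m.
     boundary U z = (\<lambda>_. 0) \<longrightarrow> (\<exists>w\<in>alt_chains R S (Suc m). boundary U w = z))"

lemma alternatingD: "alternating z \<Longrightarrow> z (xs @ x # y # ys) = - z (xs @ y # x # ys)"
  unfolding alternating_def by blast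

lemma alternatingI:
  "(\<And>xs x y ys. z (xs @ x # y # ys) = - z (xs @ y # x # ys)) \<Longrightarrow> alternating z"
  unfolding alternating_def by blast

lemma alternating_swap: "alternating z \<Longrightarrow> z (x # y # ys) = - z (y # x # ys)"
  using alternatingD[of z "[]" x y ys] by simp

lemma alternating_Cons: "alternating z \<Longrightarrow> alternating (\<lambda>L. z (v # L))"
  using alternatingD[of z "v # xs" for xs, unfolded append_Cons] by (rule alternatingI)

text \<open>Swaps carry the head next to its second copy; exchanging equal neighbours gives
  \<open>z = - z\<close>, hence zero over the integers.\<close>

lemma alternating_repeat:
  assumes "alternating z" "x \<in> set L"
  shows "z (x # L) = 0"
  using assms
proof (induction L arbitrary: z)
  case (Cons y L)
  show ?case
  proof (cases "x = y")
    case True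
    then show ?thesis using alternating_swap[OF Cons.prems(1), of x x L] by simp
  next
    case False
    have "z (x # y # L) = - z (y # x # L)" by (rule alternating_swap[OF Cons.prems(1)])
    then show ?thesis
      using Cons.IH[OF alternating_Cons[OF Cons.prems(1), of y]] Cons.prems(2) False by simp
  qed
qed simp

lemma alternating_not_distinct:
  assumes "alternating z" "\<not> distinct L"
  shows "z L = 0"
  using assms
proof (induction L arbitrary: z)
  case (Cons x L)
  then show ?case
    using alternating_repeat[of z x L] Cons.IH[OF alternating_Cons[of z x]] by auto
qed simp

lemma alternating_vanish:
  assumes "alternating z" "\<And>L. z (v # L) = 0" "v \<in> set L"
  shows "z L = 0"
  using assms
proof (induction L arbitrary: z)
  case (Cons y L)
  show ?case
  proof (cases "v = y")
    case False
    then have "v \<in> set L" using Cons.prems(3) by simp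
    moreover have "z (y # v # M) = 0" for M
      using alternating_swap[OF Cons.prems(1), of y v M] Cons.prems(2) by simp
    ultimately show ?thesis using Cons.IH[OF alternating_Cons[OF Cons.prems(1), of y]] by simp
  qed (use Cons.prems in simp)
qed simp

lemma alt_chainsI:
  assumes "alternating z" "\<And>L. z L \<noteq> 0 \<Longrightarrow> length L = l"
    "\<And>L. z L \<noteq> 0 \<Longrightarrow> set L \<subseteq> S" "\<And>L x y. z L \<noteq> 0 \<Longrightarrow> x \<in> set L \<Longrightarrow> y \<in> set L \<Longrightarrow> R x y"
  shows "z \<in> alt_chains R S l"
  using assms unfolding alt_chains_def by blast

lemma alt_chainsD:
  assumes "z \<in> alt_chains R S l"
  shows "alternating z" "z L \<noteq> 0 \<Longrightarrow> length L = l" "z L \<noteq> 0 \<Longrightarrow> set L \<subseteq> S"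
    "z L \<noteq> 0 \<Longrightarrow> x \<in> set L \<Longrightarrow> y \<in> set L \<Longrightarrow> R x y"
  using assms unfolding alt_chains_def by blast+

lemma alt_chains_mono: "z \<in> alt_chains R S l \<Longrightarrow> S \<subseteq> T \<Longrightarrow> z \<in> alt_chains R T l"
  unfolding alt_chains_def by blast

lemma alt_chains_zero: "(\<lambda>_. 0) \<in> alt_chains R S l"
  by (auto simp: alt_chains_def alternating_def)

lemma alt_chains_add:
  assumes "z \<in> alt_chains R S l" "w \<in> alt_chains R S l"
  shows "(\<lambda>L. z L + w L) \<in> alt_chains R S l"
proof -
  have *: "z L \<noteq> 0 \<or> w L \<noteq> 0" if "z L + w L \<noteq> 0" for L using that by auto
  show ?thesis
  proof (rule alt_chainsI)
    show "alternating (\<lambda>L. z L + w L)"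
    proof (rule alternatingI)
      fix xs ys x y
      show "z (xs @ x # y # ys) + w (xs @ x # y # ys) = - (z (xs @ y # x # ys) + w (xs @ y # x # ys))"
        using alternatingD[OF alt_chainsD(1)[OF assms(1)], of xs x y ys]
          alternatingD[OF alt_chainsD(1)[OF assms(2)], of xs x y ys] by simp
    qed
  next
    fix L assume "z L + w L \<noteq> 0"
    note nz = *[OF this]
    show "length L = l" using nz alt_chainsD(2) assms by blast
    show "set L \<subseteq> S" using nz alt_chainsD(3)[OF assms(1)] alt_chainsD(3)[OF assms(2)] by blast
    show "R x y" if "x \<in> set L" "y \<in> set L" for x y
      using nz alt_chainsD(4)[OF assms(1) _ that] alt_chainsD(4)[OF assms(2) _ that] by blast
  qed
qed

lemma alt_chains_minus:
  assumes "z \<in> alt_chains R S l"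
  shows "(\<lambda>L. - z L) \<in> alt_chains R S l"
proof (rule alt_chainsI)
  show "alternating (\<lambda>L. - z L)"
    by (rule alternatingI, subst alternatingD[OF alt_chainsD(1)[OF assms]]) simp
qed (use alt_chainsD[OF assms] in auto)

lemma alt_chains_diff:
  assumes "z \<in> alt_chains R S l" "w \<in> alt_chains R S l"
  shows "(\<lambda>L. z L - w L) \<in> alt_chains R S l"
  using alt_chains_add[OF assms(1) alt_chains_minus[OF assms(2)]] by simp

lemma alt_chains_sum:
  assumes "\<And>i. i \<in> I \<Longrightarrow> z i \<in> alt_chains R S l"
  shows "(\<lambda>L. \<Sum>i\<in>I. z i L) \<in> alt_chains R S l"
  using assms
  by (induction I rule: infinite_finite_induct) (auto simp: alt_chains_zero alt_chains_add)

text \<open>\<open>P\<close> sees only the vertex set, which a transposition does not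
  change.\<close>

lemma alt_chains_restrict:
  assumes "z \<in> alt_chains R S l"
  shows "(\<lambda>L. if P (set L) then z L else 0) \<in> alt_chains R S l"
proof (rule alt_chainsI)
  show "alternating (\<lambda>L. if P (set L) then z L else 0)"
    by (rule alternatingI, subst alternatingD[OF alt_chainsD(1)[OF assms]])
      (simp add: insert_commute)
qed (use alt_chainsD[OF assms] in \<open>auto split: if_splits\<close>)

lemma alt_chains_boundary:
  assumes "z \<in> alt_chains R S (Suc l)"
  shows "boundary U z \<in> alt_chains R S l"
proof -
  have *: "\<exists>v. z (v # L) \<noteq> 0" if "boundary U z L \<noteq> 0" for L
    using that unfolding boundary_def by (meson sum.neutral)
  show ?thesis
  proof (rule alt_chainsI)
    show "alternating (boundary U z)"
    proof (rule alternatingI)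
      show "boundary U z (xs @ x # y # ys) = - boundary U z (xs @ y # x # ys)" for xs x y ys
        unfolding boundary_def sum_negf[symmetric]
        by (intro sum.cong refl alternatingD[OF alternating_Cons[OF alt_chainsD(1)[OF assms]]])
    qed
  next
    fix L assume "boundary U z L \<noteq> 0"
    from *[OF this] obtain v where v: "z (v # L) \<noteq> 0" ..
    show "length L = l" using alt_chainsD(2)[OF assms v] by simp
    show "set L \<subseteq> S" using alt_chainsD(3)[OF assms v] by simp
    show "R x y" if "x \<in> set L" "y \<in> set L" for x y using alt_chainsD(4)[OF assms v] that by simp
  qed
qed

text \<open>The double sum over the two leading vertices is antisymmetric under their exchange, so
  it equals its own negative.\<close>

lemma boundary_boundary:
  assumes "alternating z"
  shows "boundary U (boundary U z) L = 0"
proof -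
  have "boundary U (boundary U z) L = (\<Sum>v\<in>U. \<Sum>w\<in>U. z (w # v # L))"
    by (simp add: boundary_def)
  also have "\<dots> = (\<Sum>v\<in>U. \<Sum>w\<in>U. - z (v # w # L))"
    by (intro sum.cong refl alternating_swap assms)
  also have "\<dots> = - (\<Sum>w\<in>U. \<Sum>v\<in>U. z (v # w # L))"
    by (subst sum.swap) (simp add: sum_negf)
  also have "\<dots> = - boundary U (boundary U z) L" by (simp add: boundary_def)
  finally show ?thesis by simp
qed

lemma boundary_add: "boundary U (\<lambda>L. z L + w L) M = boundary U z M + boundary U w M"
  by (simp add: boundary_def sum.distrib)

lemma boundary_diff: "boundary U (\<lambda>L. z L - w L) M = boundary U z M - boundary U w M"
  by (simp add: boundary_def sum_subtractf)

lemma acyclic_uptoD: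
  assumes "acyclic_upto U R l S" "m \<le> l" "z \<in> alt_chains R S m" "\<And>L. boundary U z L = 0"
  obtains w where "w \<in> alt_chains R S (Suc m)" "\<And>L. boundary U w L = z L"
proof -
  have "boundary U z = (\<lambda>_. 0)" using assms(4) by auto
  then obtain w where "w \<in> alt_chains R S (Suc m)" "boundary U w = z"
    using assms(1-3) unfolding acyclic_upto_def by blast
  then show ?thesis using that by blast
qed

lemma acyclic_uptoI:
  assumes "\<And>m z. m \<le> l \<Longrightarrow> z \<in> alt_chains R S m \<Longrightarrow> (\<And>L. boundary U z L = 0) \<Longrightarrow>
    \<exists>w\<in>alt_chains R S (Suc m). \<forall>L. boundary U w L = z L"
  shows "acyclic_upto U R l S"
  unfolding acyclic_upto_def
proof (intro allI impI ballI)
  fix m z assume "m \<le> l" "z \<in> alt_chains R S m" "boundary U z = (\<lambda>_. 0)"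
  then obtain w where "w\<in>alt_chains R S (Suc m)" "\<forall>L. boundary U w L = z L" using assms by force
  then show "\<exists>w\<in>alt_chains R S (Suc m). boundary U w = z" by (intro bexI[of _ w] ext) auto
qed

text \<open>The recursion is that of an antiderivation, which makes \<open>boundary_cone\<close> immediate.\<close>

primrec cone :: "'a \<Rightarrow> ('a list \<Rightarrow> int) \<Rightarrow> 'a list \<Rightarrow> int" where
  "cone v z [] = 0"
| "cone v z (x # L) = (if x = v then z L else 0) - cone v (\<lambda>M. z (x # M)) L"

lemma cone_minus: "cone v (\<lambda>L. - z L) M = - cone v z M"
  by (induction M arbitrary: z) simp_all

lemma cone_sum: "cone v (\<lambda>L. \<Sum>i\<in>I. z i L) M = (\<Sum>i\<in>I. cone v (z i) M)"
  by (induction M arbitrary: z) (auto simp: sum_subtractf)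

lemma cone_zero: "cone v (\<lambda>L. 0) M = 0"
  by (induction M) simp_all

lemma alternating_cone:
  assumes "alternating z"
  shows "alternating (cone v z)"
proof -
  have "cone v z (xs @ x # y # ys) = - cone v z (xs @ y # x # ys)" for xs x y ys
    using assms
  proof (induction xs arbitrary: z)
    case Nil
    have "(\<lambda>M. z (x # y # M)) = (\<lambda>M. - z (y # x # M))"
      by (rule ext) (rule alternating_swap[OF Nil])
    then show ?case by (simp add: cone_minus)
  next
    case (Cons a xs)
    show ?case
      using Cons.IH[OF alternating_Cons[OF Cons.prems, of a]] alternatingD[OF Cons.prems, of xs x y ys]
      by simp
  qed
  then show ?thesis by (rule alternatingI)
qed

lemma cone_support:
  assumes "cone v z L \<noteq> 0"
  obtains xs ys where "L = xs @ v # ys" "z (xs @ ys) \<noteq> 0"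
proof -
  have "\<exists>xs ys. L = xs @ v # ys \<and> z (xs @ ys) \<noteq> 0"
    using assms
  proof (induction L arbitrary: z)
    case (Cons x L)
    show ?case
    proof (cases "x = v \<and> z L \<noteq> 0")
      case True
      then show ?thesis by (intro exI[of _ "[]"] exI[of _ L]) auto
    next
      case False
      then have "cone v (\<lambda>M. z (x # M)) L \<noteq> 0" using Cons.prems by (auto split: if_splits)
      from Cons.IH[OF this] obtain xs ys where "L = xs @ v # ys" "z (x # xs @ ys) \<noteq> 0" by blast
      then show ?thesis by (intro exI[of _ "x # xs"] exI[of _ ys]) auto
    qed
  qed simp
  then show thesis using that by blast
qed

lemma alt_chains_cone:
  assumes z: "z \<in> alt_chains R S l" and "S \<subseteq> T" "v \<in> T" "R v v"
    and R: "\<And>x. x \<in> S \<Longrightarrow> R v x \<and> R x v"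
  shows "cone v z \<in> alt_chains R T (Suc l)"
proof (rule alt_chainsI)
  show "alternating (cone v z)" by (rule alternating_cone) (rule alt_chainsD(1)[OF z])
next
  fix L assume "cone v z L \<noteq> 0"
  then obtain xs ys where L: "L = xs @ v # ys" and nz: "z (xs @ ys) \<noteq> 0" by (rule cone_support)
  show "length L = Suc l" using alt_chainsD(2)[OF z nz] L by simp
  have sub: "set xs \<union> set ys \<subseteq> S" using alt_chainsD(3)[OF z nz] by simp
  then show "set L \<subseteq> T" using L assms(2,3) by auto
  show "R x y" if "x \<in> set L" "y \<in> set L" for x y
  proof (cases "x = v \<or> y = v")
    case True
    then show ?thesis using that sub L R assms(4) by auto
  next
    case False
    then show ?thesis using alt_chainsD(4)[OF z nz] that L by auto
  qed
qed

lemma boundary_cone: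
  assumes "finite U" "v \<in> U"
  shows "boundary U (cone v z) L = z L - cone v (boundary U z) L"
proof -
  have "boundary U (cone v z) L = (\<Sum>x\<in>U. if x = v then z L else 0) - (\<Sum>x\<in>U. cone v (\<lambda>M. z (x # M)) L)"
    by (simp add: boundary_def sum_subtractf)
  also have "(\<Sum>x\<in>U. if x = v then z L else 0) = z L" using assms by simp
  also have "(\<Sum>x\<in>U. cone v (\<lambda>M. z (x # M)) L) = cone v (boundary U z) L"
    unfolding boundary_def by (rule cone_sum[symmetric])
  finally show ?thesis .
qed

lemma boundary_cone_cycle:
  assumes "finite U" "v \<in> U" "\<And>L. boundary U z L = 0"
  shows "boundary U (cone v z) L = z L"
proof -
  have "boundary U z = (\<lambda>_. 0)" using assms(3) by auto
  then show ?thesis using boundary_cone[OF assms(1,2), of z L] by (simp add: cone_zero)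
qed

section \<open>Acyclicity of points, retracts and unions\<close>

lemma acyclic_upto_singleton:
  assumes "finite U" "v \<in> U" "R v v"
  shows "acyclic_upto U R l {v}"
proof (rule acyclic_uptoI)
  fix m and z :: "'a list \<Rightarrow> int"
  assume z: "z \<in> alt_chains R {v} m" "\<And>L. boundary U z L = 0"
  have "cone v z \<in> alt_chains R {v} (Suc m)" by (rule alt_chains_cone[OF z(1)]) (use assms in auto)
  then show "\<exists>w\<in>alt_chains R {v} (Suc m). \<forall>L. boundary U w L = z L"
    using boundary_cone_cycle[OF assms(1,2) z(2)] by blast
qed

text \<open>The only simplex without vertices is the empty one, and it lies in every
  complex.\<close>

lemma alt_chains_0_subset:
  assumes "z \<in> alt_chains R S 0"
  shows "z \<in> alt_chains R T 0"
  using assms unfolding alt_chains_def by fastforce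

text \<open>The link of \<open>v\<close> in \<open>S\<close> is a cone with apex \<open>w\<close>, so \<open>v\<close> can be removed.\<close>

lemma acyclic_upto_insert:
  assumes fin: "finite U" and U: "insert v S \<subseteq> U" and v: "v \<notin> S"
    and R: "reflp R" "symp R" and w: "w \<in> S" "R v w" "\<And>y. y \<in> S \<Longrightarrow> R v y \<Longrightarrow> R w y"
    and S: "acyclic_upto U R l S"
  shows "acyclic_upto U R l (insert v S)"
proof (rule acyclic_uptoI)
  fix m and z :: "'a list \<Rightarrow> int"
  assume ml: "m \<le> l" and z: "z \<in> alt_chains R (insert v S) m" and cyc: "\<And>L. boundary U z L = 0"
  have mono: "c \<in> alt_chains R S j \<Longrightarrow> c \<in> alt_chains R (insert v S) j" for c j
    using alt_chains_mono by blast
  show "\<exists>w\<in>alt_chains R (insert v S) (Suc m). \<forall>L. boundary U w L = z L"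
  proof (cases m)
    case 0
    then obtain c where "c \<in> alt_chains R S (Suc m)" "\<And>L. boundary U c L = z L"
      using acyclic_uptoD[OF S ml, of z] alt_chains_0_subset z cyc by metis
    then show ?thesis using mono by blast
  next
    case (Suc m')
    define K where "K = {y \<in> S. R v y}"
    \<comment> \<open>The part of \<open>z\<close> through \<open>v\<close>, as a chain on the link
      \<open>K\<close>. Coning it off from \<open>w\<close> inside the link gives
      \<open>b\<close>.\<close>
    define a where "a = (\<lambda>L. z (v # L))"
    define b where "b = cone w a"
    have wK: "w \<in> K" "v \<in> U" "w \<in> U" using w U by (auto simp: K_def)
    have a: "a \<in> alt_chains R K m'"
    proof (rule alt_chainsI)
      show "alternating a" unfolding a_def by (rule alternating_Cons) (rule alt_chainsD(1)[OF z])
    next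
      fix L assume "a L \<noteq> 0"
      then have nz: "z (v # L) \<noteq> 0" by (simp add: a_def)
      show "length L = m'" using alt_chainsD(2)[OF z nz] Suc by simp
      have "v \<notin> set L" using alternating_repeat[OF alt_chainsD(1)[OF z]] nz by blast
      then show "set L \<subseteq> K" using alt_chainsD(3,4)[OF z nz] by (auto simp: K_def)
      show "R x y" if "x \<in> set L" "y \<in> set L" for x y using alt_chainsD(4)[OF z nz] that by simp
    qed
    have a_cyc: "boundary U a L = 0" for L
    proof -
      have "boundary U a L = (\<Sum>x\<in>U. - z (x # v # L))"
        unfolding a_def boundary_def by (intro sum.cong refl alternating_swap alt_chainsD(1)[OF z])
      then show ?thesis using cyc[of "v # L"] by (simp add: boundary_def sum_negf)
    qed
    have b: "b \<in> alt_chains R K (Suc m')" unfolding b_def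
      by (rule alt_chains_cone[OF a]) (use wK R w in \<open>auto simp: K_def dest: reflpD sympD\<close>)
    have bb: "boundary U b L = a L" for L
      unfolding b_def by (rule boundary_cone_cycle[OF fin wK(3) a_cyc])
    have ca: "cone v a \<in> alt_chains R (insert v S) (Suc m')"
      by (rule alt_chains_cone[OF a]) (use R in \<open>auto simp: K_def dest: reflpD sympD\<close>)
    have cb: "cone v b \<in> alt_chains R (insert v S) (Suc (Suc m'))"
      by (rule alt_chains_cone[OF b]) (use R in \<open>auto simp: K_def dest: reflpD sympD\<close>)
    have bca: "boundary U (cone v a) L = a L" for L
      by (rule boundary_cone_cycle[OF fin wK(2) a_cyc])
    have bcb: "boundary U (cone v b) L = b L - cone v a L" for L
      using boundary_cone[OF fin wK(2), of b L] bb by (metis ext)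
    \<comment> \<open>By \<open>bcb\<close> this is \<open>z\<close> plus the boundary of
      \<open>cone v b\<close>: a homologous cycle in which the simplices through \<open>v\<close>
      cancel, so that it lives on \<open>S\<close>.\<close>
    define z' where "z' = (\<lambda>L. (z L - cone v a L) + b L)"
    have zca: "(\<lambda>L. z L - cone v a L) \<in> alt_chains R (insert v S) (Suc m')"
      using alt_chains_diff[OF z[unfolded Suc] ca] .
    have z'1: "z' \<in> alt_chains R (insert v S) (Suc m')"
      unfolding z'_def by (rule alt_chains_add[OF zca alt_chains_mono[OF b]]) (auto simp: K_def)
    \<comment> \<open>It suffices to test lists beginning with \<open>v\<close>. There
      \<open>cone v a\<close> takes the value \<open>a M\<close>, because \<open>a\<close> avoids
      \<open>v\<close>, and this is \<open>z (v # M)\<close>.\<close>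
    have van: "z' L = 0" if "v \<in> set L" for L
    proof -
      have "cone v (\<lambda>M. a (v # M)) M = 0" for M
      proof -
        have "(\<lambda>M. a (v # M)) = (\<lambda>M. 0)"
          using alternating_repeat[OF alt_chainsD(1)[OF z]] by (auto simp: a_def)
        then show ?thesis by (simp add: cone_zero)
      qed
      then have "z (v # M) - cone v a (v # M) = 0" for M by (simp add: a_def)
      then have "z L - cone v a L = 0"
        by (rule alternating_vanish[OF alt_chainsD(1)[OF zca] _ that])
      moreover have "b L = 0" using alt_chainsD(3)[OF b, of L] that v by (auto simp: K_def)
      ultimately show ?thesis by (simp add: z'_def)
    qed
    have z': "z' \<in> alt_chains R S (Suc m')"
    proof (rule alt_chainsI)
      show "set L \<subseteq> S" if "z' L \<noteq> 0" for L
        using alt_chainsD(3)[OF z'1 that] van[of L] that by blast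
    qed (use alt_chainsD[OF z'1] in blast)+
    have "boundary U z' L = 0" for L
      unfolding z'_def boundary_add boundary_diff using cyc bca bb by simp
    from acyclic_uptoD[OF S ml[unfolded Suc] z' this]
    obtain c where c: "c \<in> alt_chains R S (Suc (Suc m'))" "\<And>L. boundary U c L = z' L" by blast
    have "(\<lambda>L. c L - cone v b L) \<in> alt_chains R (insert v S) (Suc m)"
      unfolding Suc by (rule alt_chains_diff[OF mono[OF c(1)] cb])
    moreover have "boundary U (\<lambda>L. c L - cone v b L) L = z L" for L
      unfolding boundary_diff c(2) bcb z'_def by simp
    ultimately show ?thesis by blast
  qed
qed

text \<open>The points moved by \<open>f\<close> are added back to the fixed points one at a time.
  If \<open>v\<close> is a maximal moved point, whatever is comparable with \<open>v\<close> is
  comparable with \<open>f v\<close>, so the link of \<open>v\<close> is a cone with apex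
  \<open>f v\<close>.\<close>

lemma acyclic_upto_retract:
  fixes le :: "'a \<Rightarrow> 'a \<Rightarrow> bool"
  assumes "finite U" "S \<subseteq> U"
    and order: "reflp le" "transp le" "antisymp le"
    and R: "\<And>x y. R x y \<longleftrightarrow> le x y \<or> le y x"
    and "\<And>x. x \<in> S \<Longrightarrow> f x \<in> S" "\<And>x. x \<in> S \<Longrightarrow> f (f x) = f x" "\<And>x. x \<in> S \<Longrightarrow> le x (f x)"
      "\<And>x y. x \<in> S \<Longrightarrow> y \<in> S \<Longrightarrow> le x y \<Longrightarrow> le (f x) (f y)"
    and "acyclic_upto U R l {x \<in> S. f x = x}"
  shows "acyclic_upto U R l S"
proof -
  have "finite S" using assms(1,2) finite_subset by blast
  then show ?thesis using assms(2,7-)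
  proof (induction S rule: finite_psubset_induct)
    case (psubset S)
    show ?case
    proof (cases "\<exists>x\<in>S. f x \<noteq> x")
      case False
      then have "{x \<in> S. f x = x} = S" by auto
      then show ?thesis using psubset.prems by simp
    next
      case True
      define D where "D = {x \<in> S. f x \<noteq> x}"
      have "finite D" "D \<noteq> {}" using True psubset.hyps by (auto simp: D_def)
      moreover have "transp_on D (\<lambda>x y. le x y \<and> x \<noteq> y)" "asymp_on D (\<lambda>x y. le x y \<and> x \<noteq> y)"
        using order by (auto intro!: transp_onI asymp_onI dest: transpD antisympD)
      ultimately obtain v where v: "v \<in> D" "\<And>x. x \<in> D \<Longrightarrow> le v x \<Longrightarrow> x = v"
        using Finite_Set.bex_max_element[of D "\<lambda>x y. le x y \<and> x \<noteq> y"] by metis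
      have vS: "v \<in> S" "f v \<noteq> v" using v by (auto simp: D_def)
      \<comment> \<open>If \<open>f x = v\<close>, idempotence would make \<open>v\<close> a fixed
        point. Hence \<open>f\<close> still maps \<open>S - {v}\<close> into itself.\<close>
      have ne: "f x \<noteq> v" if "x \<in> S" for x using psubset.prems(3)[OF that] vS by auto
      let ?S = "S - {v}"
      have "acyclic_upto U R l ?S"
      proof (rule psubset.IH)
        have "{x \<in> ?S. f x = x} = {x \<in> S. f x = x}" using vS by auto
        then show "acyclic_upto U R l {x \<in> ?S. f x = x}" using psubset.prems by simp
      qed (use vS psubset.prems ne in auto)
      then have "acyclic_upto U R l (insert v ?S)"
      proof (rule acyclic_upto_insert[OF assms(1), rotated -1, where w = "f v"])
        show "f v \<in> ?S" using vS psubset.prems(2) by auto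
        show "R v (f v)" using psubset.prems(4) vS R by auto
        show "reflp R" "symp R" using order(1) R by (auto intro!: reflpI sympI dest: reflpD)
        fix y assume y: "y \<in> ?S" "R v y"
        show "R (f v) y"
        proof (cases "le v y")
          case True
          then have "f y = y" using v(2) y by (auto simp: D_def)
          then show ?thesis using psubset.prems(5)[OF vS(1) _ True] y R by auto
        next
          case False
          then have "le y v" using y R by blast
          then have "le y (f v)" using psubset.prems(4)[OF vS(1)] order(2) by (meson transpD)
          then show ?thesis using R by blast
        qed
      qed (use vS psubset.prems in auto)
      then show ?thesis using vS by (simp add: insert_absorb)
    qed
  qed
qed

text \<open>The Mayer--Vietoris argument: by \<open>sep\<close>, every simplex on \<open>A \<union> B\<close> lies in \<open>A\<close> or in \<open>B\<close>.\<close>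

lemma acyclic_upto_Un:
  assumes A: "acyclic_upto U R l A" and B: "acyclic_upto U R l B"
    and AB: "\<And>m. l = Suc m \<Longrightarrow> acyclic_upto U R m (A \<inter> B)"
    and sep: "\<And>x y. x \<in> A - B \<Longrightarrow> y \<in> B - A \<Longrightarrow> \<not> R x y"
  shows "acyclic_upto U R l (A \<union> B)"
proof (rule acyclic_uptoI)
  fix m and z :: "'a list \<Rightarrow> int"
  assume ml: "m \<le> l" and z: "z \<in> alt_chains R (A \<union> B) m" and cyc: "\<And>L. boundary U z L = 0"
  have mono: "c \<in> alt_chains R A j \<Longrightarrow> c \<in> alt_chains R (A \<union> B) j"
    "c \<in> alt_chains R B j \<Longrightarrow> c \<in> alt_chains R (A \<union> B) j"
    "c \<in> alt_chains R (A \<inter> B) j \<Longrightarrow> c \<in> alt_chains R A j"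
    "c \<in> alt_chains R (A \<inter> B) j \<Longrightarrow> c \<in> alt_chains R B j" for c j
    using alt_chains_mono by blast+
  show "\<exists>w\<in>alt_chains R (A \<union> B) (Suc m). \<forall>L. boundary U w L = z L"
  proof (cases m)
    \<comment> \<open>For \<open>l = 0\<close> nothing is known about \<open>A \<inter> B\<close>; a
      chain on the empty simplex is already filled inside \<open>A\<close>.\<close>
    case 0
    then obtain c where "c \<in> alt_chains R A (Suc m)" "\<And>L. boundary U c L = z L"
      using acyclic_uptoD[OF A ml, of z] alt_chains_0_subset z cyc by metis
    then show ?thesis using mono by blast
  next
    case (Suc m')
    obtain l' where l': "l = Suc l'" using ml Suc by (cases l) auto
    \<comment> \<open>Whole simplices are assigned: those inside \<open>A\<close> go to
      \<open>a\<close>, and all others lie in \<open>B\<close> and go to \<open>b\<close>.\<close>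
    define a where "a = (\<lambda>L. if set L \<subseteq> A then z L else 0)"
    define b where "b = (\<lambda>L. z L - a L)"
    have a1: "a \<in> alt_chains R (A \<union> B) m" unfolding a_def
      using alt_chains_restrict[OF z, of "\<lambda>X. X \<subseteq> A"] .
    have a: "a \<in> alt_chains R A m"
      by (rule alt_chainsI) (use alt_chainsD[OF a1] in \<open>auto simp: a_def split: if_splits\<close>)
    have b1: "b \<in> alt_chains R (A \<union> B) m" unfolding b_def by (rule alt_chains_diff[OF z a1])
    have b: "b \<in> alt_chains R B m"
    proof (rule alt_chainsI)
      fix L assume nz: "b L \<noteq> 0"
      then have "\<not> set L \<subseteq> A" "z L \<noteq> 0" by (auto simp: b_def a_def split: if_splits)
      then show "set L \<subseteq> B" using sep alt_chainsD(3,4)[OF z, of L] by blast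
    qed (use alt_chainsD[OF b1] in blast)+
    \<comment> \<open>As \<open>z\<close> is a cycle, the boundaries of \<open>a\<close> and
      \<open>b\<close> cancel, so this chain lives on \<open>A \<inter> B\<close>. It has one vertex
      fewer than \<open>z\<close>, which is why acyclicity there is asked one degree lower. Filling
      it by \<open>d\<close> makes \<open>a - d\<close> and \<open>b + d\<close> cycles.\<close>
    define c where "c = boundary U a"
    have c_b: "c = (\<lambda>L. - boundary U b L)"
      unfolding b_def boundary_diff cyc c_def by auto
    have cA: "c \<in> alt_chains R A m'" unfolding c_def by (rule alt_chains_boundary) (use a Suc in simp)
    have cB: "c \<in> alt_chains R B m'" unfolding c_b
      by (rule alt_chains_minus, rule alt_chains_boundary) (use b Suc in simp)
    have c: "c \<in> alt_chains R (A \<inter> B) m'"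
      by (rule alt_chainsI) (use alt_chainsD[OF cA] alt_chainsD[OF cB] in blast)+
    have "boundary U c L = 0" for L
      unfolding c_def by (rule boundary_boundary[OF alt_chainsD(1)[OF a]])
    then obtain d where d: "d \<in> alt_chains R (A \<inter> B) m" "\<And>L. boundary U d L = c L"
      using acyclic_uptoD[OF AB[OF l'] _ c] ml l' Suc by (metis Suc_le_mono)
    have "boundary U (\<lambda>L. a L - d L) L = 0" for L
      unfolding boundary_diff d(2) by (simp add: c_def)
    then obtain p where p: "p \<in> alt_chains R A (Suc m)" "\<And>L. boundary U p L = a L - d L"
      using acyclic_uptoD[OF A ml alt_chains_diff[OF a mono(3)[OF d(1)]]] by metis
    have "boundary U (\<lambda>L. b L + d L) L = 0" for L
      unfolding boundary_add d(2) by (simp add: c_b)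
    then obtain q where q: "q \<in> alt_chains R B (Suc m)" "\<And>L. boundary U q L = b L + d L"
      using acyclic_uptoD[OF B ml alt_chains_add[OF b mono(4)[OF d(1)]]] by metis
    have "(\<lambda>L. p L + q L) \<in> alt_chains R (A \<union> B) (Suc m)"
      using alt_chains_add[OF mono(1)[OF p(1)] mono(2)[OF q(1)]] .
    moreover have "boundary U (\<lambda>L. p L + q L) L = z L" for L
      unfolding boundary_add p(2) q(2) by (simp add: b_def)
    ultimately show ?thesis by blast
  qed
qed

section \<open>Cyclic group actions\<close>

text \<open>Only a generator is recorded. Its period is imposed on the whole type, so that applying
  a power to the entries of any list is invertible. Fixed points may occur; freeness enters through
  \<open>equivariant_sign\<close>.\<close>

locale cyclic_action =
  fixes U :: "'a set" and R :: "'a \<Rightarrow> 'a \<Rightarrow> bool" and \<gamma> :: "'a \<Rightarrow> 'a" and r :: nat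
  assumes finite_U: "finite U" and r_ge_2: "r \<ge> 2"
    and period: "(\<gamma> ^^ r) x = x"
    and closed: "x \<in> U \<Longrightarrow> \<gamma> x \<in> U"
    and R_shift: "R x y \<Longrightarrow> R (\<gamma> x) (\<gamma> y)"
begin

lemma funpow_closed: "x \<in> U \<Longrightarrow> (\<gamma> ^^ j) x \<in> U"
  by (induction j) (auto intro: closed)

lemma R_funpow: "R x y \<Longrightarrow> R ((\<gamma> ^^ j) x) ((\<gamma> ^^ j) y)"
  by (induction j) (auto intro: R_shift)

lemma funpow_mult_period: "(\<gamma> ^^ (r * j)) x = x"
  by (induction j) (simp_all add: funpow_add period)

lemma funpow_mod_period: "(\<gamma> ^^ (j mod r)) x = (\<gamma> ^^ j) x"
proof -
  have "(\<gamma> ^^ j) x = (\<gamma> ^^ (j mod r + r * (j div r))) x" by simp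
  then show ?thesis unfolding funpow_add by (simp add: funpow_mult_period)
qed

text \<open>The inverse of a power, written with a natural exponent that also works for
  \<open>j\<close> above \<open>r\<close>.\<close>

lemma funpow_inverse: "(\<gamma> ^^ (r * j - j)) ((\<gamma> ^^ j) x) = x"
proof -
  have "r * j - j + j = r * j" using r_ge_2 by simp
  then show ?thesis using funpow_mult_period[of j x] by (metis comp_apply funpow_add)
qed

lemma inj_funpow: "inj (\<gamma> ^^ j)"
  by (rule inj_on_inverseI[of _ "\<gamma> ^^ (r * j - j)"]) (rule funpow_inverse)

lemma funpow_in_iff: "(\<gamma> ^^ j) x \<in> U \<longleftrightarrow> x \<in> U"
  using funpow_closed[of "(\<gamma> ^^ j) x" "r * j - j"] funpow_inverse[of j x] funpow_closed[of x j]
  by auto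

lemma R_funpow_iff: "R ((\<gamma> ^^ j) x) ((\<gamma> ^^ j) y) \<longleftrightarrow> R x y"
  using R_funpow[of "(\<gamma> ^^ j) x" "(\<gamma> ^^ j) y" "r * j - j"] funpow_inverse[of j] R_funpow[of x y j]
  by auto

lemma bij_betw_funpow_U: "bij_betw (\<gamma> ^^ j) U U"
proof -
  have "(\<gamma> ^^ j) ` U \<subseteq> U" using funpow_closed by blast
  then have "(\<gamma> ^^ j) ` U = U"
    using endo_inj_surj[OF finite_U] inj_on_subset[OF inj_funpow] by blast
  then show ?thesis using inj_on_subset[OF inj_funpow] by (simp add: bij_betw_def)
qed

text \<open>The two differentials of the periodic resolution of the integers over the group ring of
  \<open>Z_r\<close>: generator minus one, and the norm. Composition with
  \<open>map \<gamma>\<close> moves a chain by the inverse of \<open>\<gamma>\<close>, which is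
  again a generator.\<close>

definition equiv_op :: "nat \<Rightarrow> ('a list \<Rightarrow> int) \<Rightarrow> 'a list \<Rightarrow> int" where
  "equiv_op i z L = (if even i then z (map \<gamma> L) - z L else \<Sum>j<r. z (map (\<gamma> ^^ j) L))"

lemma alt_chains_map_funpow:
  assumes "z \<in> alt_chains R U l"
  shows "(\<lambda>L. z (map (\<gamma> ^^ j) L)) \<in> alt_chains R U l"
proof (rule alt_chainsI)
  show "alternating (\<lambda>L. z (map (\<gamma> ^^ j) L))"
    by (rule alternatingI) (simp, rule alternatingD[OF alt_chainsD(1)[OF assms]])
next
  fix L assume nz: "z (map (\<gamma> ^^ j) L) \<noteq> 0"
  show "length L = l" using alt_chainsD(2)[OF assms nz] by simp
  show "set L \<subseteq> U" using alt_chainsD(3)[OF assms nz] funpow_in_iff by auto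
  show "R x y" if "x \<in> set L" "y \<in> set L" for x y
    using alt_chainsD(4)[OF assms nz, of "(\<gamma> ^^ j) x" "(\<gamma> ^^ j) y"] that R_funpow_iff by auto
qed

lemma alt_chains_equiv_op:
  assumes "z \<in> alt_chains R U l"
  shows "equiv_op i z \<in> alt_chains R U l"
proof (cases "even i")
  case True
  then have "equiv_op i z = (\<lambda>L. z (map (\<gamma> ^^ 1) L) - z L)" by (auto simp: equiv_op_def)
  then show ?thesis using alt_chains_diff[OF alt_chains_map_funpow[OF assms, of 1] assms] by simp
next
  case False
  then have "equiv_op i z = (\<lambda>L. \<Sum>j<r. z (map (\<gamma> ^^ j) L))" by (auto simp: equiv_op_def)
  then show ?thesis using alt_chains_sum[OF alt_chains_map_funpow[OF assms]] by simp
qed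

lemma boundary_map_funpow:
  "boundary U (\<lambda>L. z (map (\<gamma> ^^ j) L)) L = boundary U z (map (\<gamma> ^^ j) L)"
  unfolding boundary_def
  by (simp add: sum.reindex_bij_betw[OF bij_betw_funpow_U, of "\<lambda>v. z (v # map (\<gamma> ^^ j) L)" j])

lemma boundary_equiv_op: "boundary U (equiv_op i z) L = equiv_op i (boundary U z) L"
proof (cases "even i")
  case True
  then have "equiv_op i z = (\<lambda>L. z (map (\<gamma> ^^ 1) L) - z L)" by (auto simp: equiv_op_def)
  then show ?thesis using True boundary_map_funpow[of z 1 L]
    by (simp add: boundary_diff equiv_op_def)
next
  case False
  then have "boundary U (equiv_op i z) L = (\<Sum>v\<in>U. \<Sum>j<r. z (map (\<gamma> ^^ j) (v # L)))"
    unfolding boundary_def equiv_op_def by (simp only: if_False)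
  also have "\<dots> = (\<Sum>j<r. \<Sum>v\<in>U. z (map (\<gamma> ^^ j) (v # L)))" by (rule sum.swap)
  also have "\<dots> = (\<Sum>j<r. boundary U z (map (\<gamma> ^^ j) L))"
    by (rule sum.cong[OF refl], subst boundary_map_funpow[symmetric]) (simp add: boundary_def)
  finally show ?thesis using False by (simp add: equiv_op_def)
qed

lemma equiv_op_diff: "equiv_op i (\<lambda>L. z L - w L) L = equiv_op i z L - equiv_op i w L"
  by (simp add: equiv_op_def sum_subtractf)

lemma map_map_funpow:
  "map (\<gamma> ^^ j) (map \<gamma> L) = map (\<gamma> ^^ Suc j) L" "map \<gamma> (map (\<gamma> ^^ j) L) = map (\<gamma> ^^ Suc j) L"
  by (simp only: map_map funpow_Suc_right, simp only: map_map funpow.simps(2))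

lemma map_period: "map (\<gamma> ^^ r) L = L"
  by (simp add: map_idI period)

lemma equiv_op_equiv_op: "equiv_op (Suc i) (equiv_op i z) L = 0"
proof -
  define Y where "Y = (\<lambda>j. z (map (\<gamma> ^^ j) L))"
  have "Y r = Y 0" by (simp only: Y_def map_period funpow_0 map_idI)
  \<comment> \<open>After a full turn the last term equals the first, so shifting the summation
    index changes nothing.\<close>
  then have *: "(\<Sum>j<r. Y (Suc j)) = sum Y {..<r}"
    using sum_lessThan_telescope[of Y r] by (simp add: sum_subtractf)
  show ?thesis
  proof (cases "even i")
    case True
    then have "equiv_op (Suc i) (equiv_op i z) L
        = (\<Sum>j<r. z (map \<gamma> (map (\<gamma> ^^ j) L)) - z (map (\<gamma> ^^ j) L))"
      unfolding equiv_op_def by (simp only: even_Suc if_True if_False not_True_eq_False)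
    also have "\<dots> = (\<Sum>j<r. Y (Suc j) - Y j)" by (simp only: map_map_funpow Y_def)
    finally show ?thesis using * by (simp add: sum_subtractf)
  next
    case False
    then have "equiv_op (Suc i) (equiv_op i z) L
        = (\<Sum>j<r. z (map (\<gamma> ^^ j) (map \<gamma> L))) - (\<Sum>j<r. z (map (\<gamma> ^^ j) L))"
      unfolding equiv_op_def by (simp only: even_Suc if_True if_False not_False_eq_True)
    also have "\<dots> = (\<Sum>j<r. Y (Suc j)) - sum Y {..<r}" by (simp only: map_map_funpow Y_def)
    finally show ?thesis using * by simp
  qed
qed

text \<open>The chains are built one after another: the boundary prescribed for the next one is a
  cycle because consecutive operators compose to zero, and acyclicity fills it.\<close>

lemma ex_resolution:
  assumes "acyclic_upto U R d U"
  shows "\<exists>z. (\<forall>i\<le>d. z i \<in> alt_chains R U (Suc i)) \<and> boundary U (z 0) [] = 1 \<and>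
    (\<forall>i<d. \<forall>L. boundary U (z (Suc i)) L = equiv_op i (z i) L)"
proof -
  \<comment> \<open>The unit chain on the empty simplex. It is invariant, hence killed by the first
    operator, which starts the recursion.\<close>
  define \<epsilon> :: "'a list \<Rightarrow> int" where "\<epsilon> = (\<lambda>L. if L = [] then 1 else 0)"
  have "\<exists>z. (\<forall>i\<le>e. z i \<in> alt_chains R U (Suc i)) \<and> (\<forall>L. boundary U (z 0) L = \<epsilon> L) \<and>
    (\<forall>i<e. \<forall>L. boundary U (z (Suc i)) L = equiv_op i (z i) L)" if "e \<le> d" for e
    using that
  proof (induction e)
    case 0
    have "\<epsilon> \<in> alt_chains R U 0"
      by (rule alt_chainsI) (auto simp: \<epsilon>_def intro: alternatingI split: if_splits)
    moreover have "boundary U \<epsilon> L = 0" for L by (simp add: boundary_def \<epsilon>_def)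
    ultimately obtain w where "w \<in> alt_chains R U (Suc 0)" "\<And>L. boundary U w L = \<epsilon> L"
      using acyclic_uptoD[OF assms, of 0 \<epsilon>] by blast
    then show ?case by (intro exI[of _ "\<lambda>_. w"]) auto
  next
    case (Suc e)
    from Suc.IH[OF Suc_leD[OF Suc.prems]] obtain z where z: "\<And>i. i \<le> e \<Longrightarrow> z i \<in> alt_chains R U (Suc i)"
      "\<And>L. boundary U (z 0) L = \<epsilon> L"
      "\<And>i L. i < e \<Longrightarrow> boundary U (z (Suc i)) L = equiv_op i (z i) L" by blast
    have "equiv_op e (boundary U (z e)) L = 0" for L
    proof (cases e)
      case 0
      have "boundary U (z 0) = \<epsilon>" using z(2) by auto
      then show ?thesis using 0 by (simp add: equiv_op_def \<epsilon>_def)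
    next
      case (Suc j)
      then have "boundary U (z e) = equiv_op j (z j)" using z(3)[of j] by auto
      then show ?thesis using Suc by (simp add: equiv_op_equiv_op)
    qed
    then have cyc: "boundary U (equiv_op e (z e)) L = 0" for L by (simp only: boundary_equiv_op)
    \<comment> \<open>The cycle to be filled has \<open>Suc e\<close> vertices, so
      \<open>Suc e \<le> d\<close> is exactly what is needed.\<close>
    obtain w where w: "w \<in> alt_chains R U (Suc (Suc e))"
      "\<And>L. boundary U w L = equiv_op e (z e) L"
      by (rule acyclic_uptoD[OF assms Suc.prems alt_chains_equiv_op[OF z(1)[OF order_refl]] cyc]) blast
    show ?case
      by (rule exI[of _ "z(Suc e := w)"]) (use z w in \<open>auto simp: le_Suc_eq less_Suc_eq\<close>)
  qed
  from this[OF order_refl] obtain z where z: "\<forall>i\<le>d. z i \<in> alt_chains R U (Suc i)"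
    "\<forall>L. boundary U (z 0) L = \<epsilon> L" "\<forall>i<d. \<forall>L. boundary U (z (Suc i)) L = equiv_op i (z i) L"
    by blast
  moreover from z(2) have "boundary U (z 0) [] = 1" by (simp only: \<epsilon>_def) simp
  ultimately show ?thesis by blast
qed

text \<open>An equivariant choice of a group element for every simplex: the chain modules are free.\<close>

definition equivariant_sign :: "('a set \<Rightarrow> nat) \<Rightarrow> bool" where
  "equivariant_sign sg \<longleftrightarrow> (\<forall>X. X \<subseteq> U \<and> X \<noteq> {} \<and> (\<forall>x\<in>X. \<forall>y\<in>X. R x y) \<longrightarrow>
     sg X < r \<and> sg (\<gamma> ` X) = Suc (sg X) mod r)"

text \<open>Exactness for free modules, with \<open>sg\<close> as coordinate along each orbit: an
  invariant chain is a norm, and a chain of norm zero is a difference of a chain and its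
  translate.\<close>

lemma equiv_op_exact:
  assumes sg: "equivariant_sign sg"
    and y: "y \<in> alt_chains R U (Suc l)" and zero: "\<And>L. equiv_op i y L = 0"
  shows "\<exists>u\<in>alt_chains R U (Suc l). \<forall>L. equiv_op (Suc i) u L = y L"
proof -
  have sg_y: "sg (set L) < r \<and> sg (set (map \<gamma> L)) = Suc (sg (set L)) mod r" if "y L \<noteq> 0" for L
  proof -
    have "set L \<noteq> {}" using alt_chainsD(2)[OF y that] by auto
    then show ?thesis using sg alt_chainsD(3,4)[OF y that] by (simp add: equivariant_sign_def)
  qed
  show ?thesis
  proof (cases "even i")
    case True
    have y_shift: "y (map \<gamma> L) = y L" for L using zero[of L] True by (simp add: equiv_op_def)
    have y_pow: "y (map (\<gamma> ^^ j) L) = y L" for j L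
    proof (induction j)
      case (Suc j)
      then show ?case using y_shift map_map_funpow(2) by metis
    qed (simp add: map_idI)
    \<comment> \<open>One representative of each orbit is kept. The translates of a simplex run once
      through all signs, so the norm of \<open>u\<close> gives back the invariant
      \<open>y\<close>.\<close>
    define u where "u = (\<lambda>L. if sg (set L) = 0 then y L else 0)"
    have "u \<in> alt_chains R U (Suc l)"
      unfolding u_def using alt_chains_restrict[OF y, of "\<lambda>X. sg X = 0"] .
    moreover have "equiv_op (Suc i) u L = y L" for L
    proof (cases "y L = 0")
      case True
      then show ?thesis using \<open>even i\<close> y_pow by (auto simp: equiv_op_def u_def intro!: sum.neutral)
    next
      case False
      define s where "s = sg (set L)"
      have s: "s < r" using sg_y[OF False] by (simp add: s_def)
      have sgj: "sg (set (map (\<gamma> ^^ j) L)) = (s + j) mod r" for j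
      proof (induction j)
        case 0
        then show ?case using s by (simp add: s_def)
      next
        case (Suc j)
        have "y (map (\<gamma> ^^ j) L) \<noteq> 0" using False y_pow by simp
        from sg_y[OF this] show ?case
          unfolding map_map_funpow(2) Suc by (simp add: mod_simps)
      qed
      have uniq: "(s + j) mod r = 0 \<longleftrightarrow> j = (r - s) mod r" if "j < r" for j
      proof (cases "s + j < r")
        case True
        then show ?thesis using s that by (cases "s = 0") auto
      next
        case False
        then have "(s + j) mod r = s + j - r" using s that by (simp add: le_mod_geq)
        then show ?thesis using False s that by (cases "s = 0") auto
      qed
      have "equiv_op (Suc i) u L = (\<Sum>j<r. u (map (\<gamma> ^^ j) L))"
        using \<open>even i\<close> by (simp add: equiv_op_def)
      also have "\<dots> = (\<Sum>j<r. if j = (r - s) mod r then y L else 0)"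
        by (intro sum.cong refl) (simp add: u_def sgj y_pow uniq del: set_map)
      also have "\<dots> = y L" using r_ge_2 by simp
      finally show ?thesis .
    qed
    ultimately show ?thesis by blast
  next
    case False
    \<comment> \<open>For \<open>L\<close> of sign \<open>s\<close>, this sums \<open>y\<close> over
      the translates of \<open>L\<close> with signs \<open>0\<close> to \<open>s - 1\<close>, since
      the translate by \<open>r - s\<close> has sign \<open>0\<close>. Passing to
      \<open>map \<gamma> L\<close> adds the term of \<open>L\<close>; at the wrap from
      \<open>r - 1\<close> to \<open>0\<close> the vanishing of the full orbit sum gives the same
      difference.\<close>
    define u where
      "u = (\<lambda>L. \<Sum>j<r. if r - sg (set L) \<le> j then y (map (\<gamma> ^^ j) L) else 0)"
    have "u \<in> alt_chains R U (Suc l)" unfolding u_def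
      by (intro alt_chains_sum)
        (rule alt_chains_restrict[OF alt_chains_map_funpow[OF y], of "\<lambda>X. r - sg X \<le> _"])
    moreover have "equiv_op (Suc i) u L = y L" for L
    \<comment> \<open>The values of \<open>sg\<close> are controlled only on simplices, so an orbit
      on which \<open>y\<close> vanishes is settled separately.\<close>
    proof (cases "\<exists>j. y (map (\<gamma> ^^ j) L) \<noteq> 0")
      case none: False
      then have "y L = 0" using map_period by metis
      moreover have "u L = 0" unfolding u_def using none by (intro sum.neutral) auto
      moreover have "u (map \<gamma> L) = 0"
      proof -
        have "y (map (\<gamma> ^^ j) L) = 0" for j using none by blast
        then show ?thesis unfolding u_def map_map_funpow by (simp only: if_cancel sum.neutral_const)
      qed
      ultimately show ?thesis using False by (simp add: equiv_op_def)
    next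
      case True
      then obtain j where j: "y (map (\<gamma> ^^ j) L) \<noteq> 0" by blast
      have ne: "set L \<noteq> {}" using alt_chainsD(2)[OF y j] by auto
      have sub: "set L \<subseteq> U" using alt_chainsD(3)[OF y j] funpow_in_iff by auto
      have Rxy: "R a b" if "a \<in> set L" "b \<in> set L" for a b
        using alt_chainsD(4)[OF y j, of "(\<gamma> ^^ j) a" "(\<gamma> ^^ j) b"] that R_funpow_iff by auto
      define s where "s = sg (set L)"
      have s: "s < r" "sg (set (map \<gamma> L)) = Suc s mod r" using sg sub ne Rxy by (simp_all add: s_def equivariant_sign_def)
      define Y where "Y = (\<lambda>j. y (map (\<gamma> ^^ j) L))"
      have ivl: "(\<Sum>j<r. if m \<le> j then g j else 0) = sum g {m..<r}" for m and g :: "nat \<Rightarrow> int"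
        by (rule sum.mono_neutral_cong_right) auto
      have u1: "u L = sum Y {r - s..<r}" unfolding u_def s_def[symmetric] Y_def ivl ..
      have u2: "u (map \<gamma> L) = (\<Sum>j=r - Suc s mod r..<r. Y (Suc j))"
        unfolding u_def s(2) map_map_funpow Y_def ivl ..
      have Yr: "Y r = y L" by (simp only: Y_def map_period)
      have "u (map \<gamma> L) - u L = y L"
      proof (cases "Suc s < r")
        case True
        then have "Suc s mod r = Suc s" "Suc (r - Suc s) = r - s" by simp_all
        then have "u (map \<gamma> L) = sum Y {r - s..<Suc r}"
          unfolding u2 sum.shift_bounds_Suc_ivl[symmetric] by simp
        then show ?thesis unfolding u1 using Yr by (simp split: if_splits)
      next
        case False
        then have "Suc s = r" using s by simp
        then have "Suc s mod r = 0" "r - s = Suc 0" by auto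
        then have "u (map \<gamma> L) = 0" "u L = sum Y {Suc 0..<r}" unfolding u1 u2 by simp_all
        moreover have "sum Y {..<r} = 0"
          using zero[of L] \<open>odd i\<close> by (simp add: equiv_op_def Y_def)
        moreover have "sum Y {..<r} = Y 0 + sum Y {Suc 0..<r}"
          using r_ge_2 by (simp add: lessThan_atLeast0 sum.atLeast_Suc_lessThan)
        moreover have "Y 0 = y L" by (simp add: Y_def map_idI)
        ultimately show ?thesis by simp
      qed
      then show ?thesis using \<open>odd i\<close> by (simp add: equiv_op_def)
    qed
    ultimately show ?thesis by blast
  qed
qed

text \<open>Descending from \<open>y d = 0\<close>, each \<open>y i\<close> is a boundary plus a
  value of the operator of index \<open>Suc i\<close>. For \<open>i = 0\<close> that operator is the
  norm, and augmentation turns the equation into \<open>1\<close> being a multiple of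
  \<open>r\<close>.\<close>

lemma no_short_resolution:
  assumes sg: "equivariant_sign sg"
    and y: "\<And>i. i \<le> d \<Longrightarrow> y i \<in> alt_chains R U (Suc i)" "boundary U (y 0) [] = 1"
      "\<And>i L. i < d \<Longrightarrow> boundary U (y (Suc i)) L = equiv_op i (y i) L"
    and yd: "\<And>L. y d L = 0"
  shows False
proof -
  have "\<exists>u\<in>alt_chains R U (Suc (Suc 0)). \<exists>v\<in>alt_chains R U (Suc 0).
      \<forall>L. y 0 L - boundary U u L = equiv_op (Suc 0) v L"
  proof (rule inc_induct[of 0 d "\<lambda>i. \<exists>u\<in>alt_chains R U (Suc (Suc i)). \<exists>v\<in>alt_chains R U (Suc i).
      \<forall>L. y i L - boundary U u L = equiv_op (Suc i) v L"])
    show "\<exists>u\<in>alt_chains R U (Suc (Suc d)). \<exists>v\<in>alt_chains R U (Suc d).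
      \<forall>L. y d L - boundary U u L = equiv_op (Suc d) v L"
      by (intro bexI[of _ "\<lambda>_. 0"]) (auto simp: yd boundary_def equiv_op_def alt_chains_zero)
  next
    fix i assume i: "i < d"
    assume "\<exists>u\<in>alt_chains R U (Suc (Suc (Suc i))). \<exists>v\<in>alt_chains R U (Suc (Suc i)).
      \<forall>L. y (Suc i) L - boundary U u L = equiv_op (Suc (Suc i)) v L"
    then obtain u v where u: "u \<in> alt_chains R U (Suc (Suc (Suc i)))"
      and v: "v \<in> alt_chains R U (Suc (Suc i))"
      and uv: "\<And>L. y (Suc i) L - boundary U u L = equiv_op i v L"
      by (auto simp: equiv_op_def)
    \<comment> \<open>The operators of index \<open>i\<close> and \<open>Suc (Suc i)\<close>
      coincide. Taking boundaries in \<open>uv\<close> shows that \<open>y i\<close> minus the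
      boundary of \<open>v\<close> is killed by \<open>equiv_op i\<close>, so exactness applies and
      \<open>v\<close> becomes the next \<open>u\<close>.\<close>
    have "equiv_op i (y i) L = equiv_op i (boundary U v) L" for L
    proof -
      have "equiv_op i v = (\<lambda>L. y (Suc i) L - boundary U u L)" using uv by auto
      then have "equiv_op i (boundary U v) L = boundary U (\<lambda>L. y (Suc i) L - boundary U u L) L"
        using boundary_equiv_op[of i v L] by simp
      then show ?thesis
        using y(3)[OF i] boundary_boundary[OF alt_chainsD(1)[OF u]] by (simp add: boundary_diff)
    qed
    then have "equiv_op i (\<lambda>L. y i L - boundary U v L) L = 0" for L by (simp add: equiv_op_diff)
    moreover have "(\<lambda>L. y i L - boundary U v L) \<in> alt_chains R U (Suc i)"
      by (rule alt_chains_diff[OF y(1) alt_chains_boundary[OF v]]) (use i in simp)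
    ultimately obtain w where "w \<in> alt_chains R U (Suc i)"
      "\<forall>L. equiv_op (Suc i) w L = y i L - boundary U v L"
      using equiv_op_exact[OF sg] by blast
    then show "\<exists>u\<in>alt_chains R U (Suc (Suc i)). \<exists>v\<in>alt_chains R U (Suc i).
      \<forall>L. y i L - boundary U u L = equiv_op (Suc i) v L"
      using v by (intro bexI[of _ v] bexI[of _ w]) auto
  qed simp
  then obtain u v where u: "u \<in> alt_chains R U (Suc (Suc 0))"
    and uv: "\<And>L. equiv_op (Suc 0) v L = y 0 L - boundary U u L" by metis
  have "equiv_op (Suc 0) v = (\<lambda>L. y 0 L - boundary U u L)" using uv by auto
  then have "equiv_op (Suc 0) (boundary U v) [] = boundary U (y 0) [] - boundary U (boundary U u) []"
    using boundary_equiv_op[of "Suc 0" v "[]"] by (simp add: boundary_diff)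
  \<comment> \<open>On the empty list all translates agree, so the norm multiplies by
    \<open>r\<close>.\<close>
  then have "int r * boundary U v [] = 1"
    using y(2) boundary_boundary[OF alt_chainsD(1)[OF u]] by (simp add: equiv_op_def)
  then show False using r_ge_2 by (metis dvd_triv_left int_dvd_int_iff nat_dvd_1_iff_1 of_nat_1 numeral_le_one_iff semiring_norm(69))
qed

end

section \<open>Push-forward of chains along a vertex map\<close>

primrec push :: "'a set \<Rightarrow> ('a \<Rightarrow> 'b) \<Rightarrow> ('a list \<Rightarrow> int) \<Rightarrow> 'b list \<Rightarrow> int" where
  "push U f z [] = z []"
| "push U f z (w # M) = (\<Sum>v | v \<in> U \<and> f v = w. push U f (\<lambda>L. z (v # L)) M)"

lemma push_minus: "push U f (\<lambda>L. - z L) M = - push U f z M"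
  by (induction M arbitrary: z) (simp_all add: sum_negf)

lemma push_diff: "push U f (\<lambda>L. z L - w L) M = push U f z M - push U f w M"
  by (induction M arbitrary: z w) (simp_all add: sum_subtractf)

lemma push_sum: "push U f (\<lambda>L. \<Sum>i\<in>I. z i L) M = (\<Sum>i\<in>I. push U f (z i) M)"
proof (induction M arbitrary: z)
  case (Cons w M)
  show ?case by (simp only: push.simps Cons.IH) (rule sum.swap)
qed simp

lemma push_support:
  assumes "push U f z M \<noteq> 0"
  obtains L where "set L \<subseteq> U" "map f L = M" "z L \<noteq> 0"
proof -
  have "\<exists>L. set L \<subseteq> U \<and> map f L = M \<and> z L \<noteq> 0"
    using assms
  proof (induction M arbitrary: z)
    case (Cons w M)
    then obtain v where v: "v \<in> U" "f v = w" "push U f (\<lambda>L. z (v # L)) M \<noteq> 0"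
      by (auto elim!: sum.not_neutral_contains_not_neutral)
    from Cons.IH[OF v(3)] obtain L where "set L \<subseteq> U" "map f L = M" "z (v # L) \<noteq> 0" by blast
    then show ?case using v by (intro exI[of _ "v # L"]) auto
  qed simp
  then show thesis using that by blast
qed

text \<open>This is also how degenerate images disappear: an alternating function vanishes on lists
  with a repeated vertex.\<close>

lemma alternating_push:
  assumes "alternating z"
  shows "alternating (push U f z)"
proof -
  have "push U f z (xs @ x # y # ys) = - push U f z (xs @ y # x # ys)" for xs x y ys
    using assms
  proof (induction xs arbitrary: z)
    case Nil
    have "push U f z ([] @ x # y # ys)
        = (\<Sum>v | v \<in> U \<and> f v = x. \<Sum>u | u \<in> U \<and> f u = y. push U f (\<lambda>L. z (v # u # L)) ys)"
      by simp
    also have "\<dots> = (\<Sum>v | v \<in> U \<and> f v = x. \<Sum>u | u \<in> U \<and> f u = y. push U f (\<lambda>L. - z (u # v # L)) ys)"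
      by (intro sum.cong refl arg_cong2[of _ _ _ _ "push U f"] ext alternating_swap Nil)
    also have "\<dots> = - (\<Sum>u | u \<in> U \<and> f u = y. \<Sum>v | v \<in> U \<and> f v = x. push U f (\<lambda>L. z (u # v # L)) ys)"
      by (subst sum.swap) (simp add: sum_negf push_minus)
    finally show ?case by simp
  next
    case (Cons a xs)
    show ?case using Cons.IH[OF alternating_Cons[OF Cons.prems]] by (simp add: sum_negf[symmetric])
  qed
  then show ?thesis by (rule alternatingI)
qed

lemma alt_chains_push:
  assumes z: "z \<in> alt_chains R U l" and f: "\<And>x. x \<in> U \<Longrightarrow> f x \<in> V"
    and R: "\<And>x y. x \<in> U \<Longrightarrow> y \<in> U \<Longrightarrow> R x y \<Longrightarrow> Q (f x) (f y)"
  shows "push U f z \<in> alt_chains Q V l"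
proof (rule alt_chainsI)
  show "alternating (push U f z)" by (rule alternating_push) (rule alt_chainsD(1)[OF z])
next
  fix M assume "push U f z M \<noteq> 0"
  then obtain L where L: "set L \<subseteq> U" "map f L = M" "z L \<noteq> 0" by (rule push_support)
  note nz = L(3)
  show "length M = l" using alt_chainsD(2)[OF z nz] L(2) by auto
  show "set M \<subseteq> V" using L(1,2) f by fastforce
  show "Q x y" if xy: "x \<in> set M" "y \<in> set M" for x y
  proof -
    obtain x' y' where "x' \<in> set L" "y' \<in> set L" "x = f x'" "y = f y'"
      using xy by (auto simp flip: L(2))
    then show ?thesis using R L(1) alt_chainsD(4)[OF z nz] by blast
  qed
qed

lemma boundary_push:
  assumes "finite U" "finite V" "\<And>x. x \<in> U \<Longrightarrow> f x \<in> V"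
  shows "boundary V (push U f z) M = push U f (boundary U z) M"
proof -
  have "boundary V (push U f z) M
      = (\<Sum>w\<in>V. \<Sum>v | v \<in> U \<and> f v = w. push U f (\<lambda>L. z (v # L)) M)"
    by (simp add: boundary_def)
  also have "\<dots> = (\<Sum>v\<in>U. push U f (\<lambda>L. z (v # L)) M)"
    by (rule sum.group) (use assms in auto)
  also have "\<dots> = push U f (boundary U z) M"
    unfolding boundary_def by (rule push_sum[symmetric])
  finally show ?thesis .
qed

text \<open>The bijection \<open>g\<close> carries the fibre of \<open>f\<close> over
  \<open>w\<close> onto the fibre over \<open>h w\<close>.\<close>

lemma push_map:
  assumes "bij_betw g U U" "inj h" "\<And>v. v \<in> U \<Longrightarrow> f (g v) = h (f v)"
  shows "push U f (\<lambda>L. z (map g L)) M = push U f z (map h M)"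
proof (induction M arbitrary: z)
  case (Cons w M)
  have "push U f (\<lambda>L. z (map g L)) (w # M)
      = (\<Sum>v | v \<in> U \<and> f v = w. push U f (\<lambda>L. z (g v # map g L)) M)" by simp
  also have "\<dots> = (\<Sum>v | v \<in> U \<and> f v = w. push U f (\<lambda>L. z (g v # L)) (map h M))"
    by (intro sum.cong refl Cons.IH)
  also have "\<dots> = (\<Sum>v | v \<in> U \<and> f v = h w. push U f (\<lambda>L. z (v # L)) (map h M))"
  proof (rule sum.reindex_bij_betw)
    have "g ` {v. v \<in> U \<and> f v = w} = {v. v \<in> U \<and> f v = h w}"
    proof (intro equalityI subsetI)
      fix v assume v: "v \<in> {v. v \<in> U \<and> f v = h w}"
      then obtain v' where "v' \<in> U" "v = g v'" using assms(1) by (auto simp: bij_betw_def)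
      moreover from this have "f v' = w" using v assms(2,3) by (auto dest: injD)
      ultimately show "v \<in> g ` {v. v \<in> U \<and> f v = w}" by blast
    qed (use assms in \<open>auto simp: bij_betw_def\<close>)
    then show "bij_betw g {v. v \<in> U \<and> f v = w} {v. v \<in> U \<and> f v = h w}"
      using assms(1) by (auto simp: bij_betw_def intro: inj_on_subset)
  qed
  finally show ?case by simp
qed simp

text \<open>The labels \<open>(s, a)\<close> form an equivariant simplicial map to the join of
  \<open>d\<close> copies of \<open>Z_r\<close>. A simplex there has at most \<open>d\<close>
  vertices, so the last chain of the resolution, which has \<open>d + 1\<close>, is pushed to
  zero.\<close>

lemma (in cyclic_action) no_equivariant_labelling:
  assumes acyc: "acyclic_upto U R d U"
    and a: "\<And>x. x \<in> U \<Longrightarrow> a x < d" "\<And>x. x \<in> U \<Longrightarrow> a (\<gamma> x) = a x"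
    and s: "\<And>x. x \<in> U \<Longrightarrow> s x < r" "\<And>x. x \<in> U \<Longrightarrow> s (\<gamma> x) = Suc (s x) mod r"
    and sa: "\<And>x y. x \<in> U \<Longrightarrow> y \<in> U \<Longrightarrow> R x y \<Longrightarrow> a x = a y \<Longrightarrow> s x = s y"
  shows False
proof -
  define V where "V = {..<r} \<times> {..<d}"
  \<comment> \<open>The join: a simplex contains at most one point of each copy.\<close>
  define Q :: "nat \<times> nat \<Rightarrow> nat \<times> nat \<Rightarrow> bool" where "Q = (\<lambda>p q. snd p = snd q \<longrightarrow> fst p = fst q)"
  \<comment> \<open>Points outside the copies are fixed, so that the period holds on the whole
    type.\<close>
  define \<delta> where "\<delta> = (\<lambda>(t, b :: nat). (if t < r then Suc t mod r else t, b))"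
  define f where "f = (\<lambda>x. (s x, a x))"
  have \<delta>_pow: "(\<delta> ^^ j) (t, b) = (if t < r then (t + j) mod r else t, b)" for j t b
    by (induction j) (use r_ge_2 in \<open>auto simp: \<delta>_def mod_simps\<close>)
  interpret T: cyclic_action V Q \<delta> r
  proof
    show "finite V" by (simp add: V_def)
    show "2 \<le> r" by (rule r_ge_2)
    show "(\<delta> ^^ r) x = x" for x by (cases x) (simp add: \<delta>_pow)
    show "\<delta> x \<in> V" if "x \<in> V" for x using that r_ge_2 by (auto simp: V_def \<delta>_def)
    show "Q (\<delta> x) (\<delta> y)" if "Q x y" for x y
      using that by (auto simp: Q_def \<delta>_def split: prod.splits)
  qed
  have fV: "f x \<in> V" if "x \<in> U" for x using a(1) s(1) that by (simp add: f_def V_def)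
  have fQ: "Q (f x) (f y)" if "x \<in> U" "y \<in> U" "R x y" for x y
    using sa that by (simp add: f_def Q_def)
  have f\<gamma>: "f (\<gamma> x) = \<delta> (f x)" if "x \<in> U" for x
    using a(2) s that by (simp add: f_def \<delta>_def)
  have f_pow: "f ((\<gamma> ^^ j) x) = (\<delta> ^^ j) (f x)" if "x \<in> U" for x j
    using that by (induction j) (simp_all add: f\<gamma> funpow_closed)
  have bp: "boundary V (push U f z) M = push U f (boundary U z) M" for z M
    by (rule boundary_push[OF finite_U T.finite_U]) (rule fV)
  have push_pow: "push U f (\<lambda>L. z (map (\<gamma> ^^ j) L)) M = push U f z (map (\<delta> ^^ j) M)" for j z M
    by (rule push_map[OF bij_betw_funpow_U T.inj_funpow]) (rule f_pow)
  have push_op: "push U f (equiv_op i z) M = T.equiv_op i (push U f z) M" for i z M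
  proof (cases "even i")
    case True
    have "equiv_op i z = (\<lambda>L. z (map (\<gamma> ^^ 1) L) - z L)" using True by (auto simp: equiv_op_def)
    then show ?thesis
      using push_pow[of z 1 M] True
      by (simp add: push_diff T.equiv_op_def)
  next
    case False
    have "equiv_op i z = (\<lambda>L. \<Sum>j<r. z (map (\<gamma> ^^ j) L))" using False by (auto simp: equiv_op_def)
    then have "push U f (equiv_op i z) M = (\<Sum>j<r. push U f (\<lambda>L. z (map (\<gamma> ^^ j) L)) M)"
      by (simp only: push_sum)
    also have "\<dots> = (\<Sum>j<r. push U f z (map (\<delta> ^^ j) M))" by (intro sum.cong refl push_pow)
    finally show ?thesis using False by (simp add: T.equiv_op_def)
  qed
  obtain z where z: "\<And>i. i \<le> d \<Longrightarrow> z i \<in> alt_chains R U (Suc i)" "boundary U (z 0) [] = 1"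
    "\<And>i L. i < d \<Longrightarrow> boundary U (z (Suc i)) L = equiv_op i (z i) L"
    using ex_resolution[OF acyc] by blast
  define y where "y = (\<lambda>i. push U f (z i))"
  have y: "y i \<in> alt_chains Q V (Suc i)" if "i \<le> d" for i
    unfolding y_def by (rule alt_chains_push[OF z(1)[OF that]]) (use fV fQ in blast)+
  \<comment> \<open>The position of the simplex in the lowest copy that it meets. \<open>Q\<close>
    makes the point unique, and \<open>\<delta>\<close> preserves the copy and advances the
    position.\<close>
  define sg where "sg = (\<lambda>X :: (nat \<times> nat) set. SOME t. (t, Min (snd ` X)) \<in> X)"
  have sg: "(sg X, Min (snd ` X)) \<in> X" if "finite X" "X \<noteq> {}" for X :: "(nat \<times> nat) set"
  proof -
    have "Min (snd ` X) \<in> snd ` X" using that by simp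
    then show ?thesis unfolding sg_def by (intro someI_ex[of "\<lambda>t. (t, Min (snd ` X)) \<in> X"]) auto
  qed
  have "T.equivariant_sign sg"
    unfolding T.equivariant_sign_def
  proof (intro allI impI, elim conjE)
    fix X assume X: "X \<subseteq> V" "X \<noteq> {}" "\<forall>p\<in>X. \<forall>q\<in>X. Q p q"
    have fin: "finite X" using X(1) T.finite_U finite_subset by blast
    have sgX: "(sg X, Min (snd ` X)) \<in> X" by (rule sg[OF fin X(2)])
    have snd_\<delta>: "snd (\<delta> p) = snd p" for p by (simp add: \<delta>_def split: prod.splits)
    then have snd: "snd ` \<delta> ` X = snd ` X" by (simp add: image_image)
    have "(sg (\<delta> ` X), Min (snd ` X)) \<in> \<delta> ` X"
      using sg[of "\<delta> ` X"] fin X(2) by (simp add: snd)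
    then obtain p where p: "p \<in> X" "(sg (\<delta> ` X), Min (snd ` X)) = \<delta> p" by blast
    have "snd p = Min (snd ` X)" using snd_\<delta>[of p] by (simp flip: p(2))
    moreover have "Q p (sg X, Min (snd ` X))" using X(3) p(1) sgX by blast
    ultimately have p_eq: "p = (sg X, Min (snd ` X))" by (simp add: Q_def prod_eq_iff)
    have "sg X < r" using sgX X(1) by (auto simp: V_def)
    then show "sg X < r \<and> sg (\<delta> ` X) = Suc (sg X) mod r"
      using p(2) unfolding p_eq by (simp add: \<delta>_def)
  qed
  then show False
  proof (rule T.no_short_resolution[of sg d y])
    fix i assume "i \<le> d"
    then show "y i \<in> alt_chains Q V (Suc i)" by (rule y)
  next
    show "boundary V (y 0) [] = 1"
      unfolding y_def bp using z(2) by simp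
  next
    fix i L assume "i < d"
    then have "boundary U (z (Suc i)) = equiv_op i (z i)" using z(3) by auto
    then show "boundary V (y (Suc i)) L = T.equiv_op i (y i) L"
      unfolding y_def bp by (simp add: push_op)
  next
    fix L
    have yd: "y d \<in> alt_chains Q V (Suc d)" by (rule y) simp
    show "y d L = 0"
    proof (rule ccontr)
      assume nz: "y d L \<noteq> 0"
      have "distinct L" using alternating_not_distinct[OF alt_chainsD(1)[OF yd]] nz by blast
      then have "card (set L) = Suc d"
        using alt_chainsD(2)[OF yd nz] by (simp add: distinct_card)
      moreover have "inj_on snd (set L)"
      proof (rule inj_onI)
        fix p q assume pq: "p \<in> set L" "q \<in> set L" "snd p = snd q"
        from alt_chainsD(4)[OF yd nz pq(1,2)] show "p = q" using pq(3) by (simp add: Q_def prod_eq_iff)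
      qed
      then have "card (set L) \<le> card {..<d}"
        by (rule card_inj_on_le) (use alt_chainsD(3)[OF yd nz] in \<open>auto simp: V_def\<close>)
      ultimately show False by simp
    qed
  qed
qed

text \<open>An orbit carries \<open>r\<close> distinct colours below \<open>m\<close>, so its least
  colour is at most \<open>m - r\<close>. If this were always below \<open>d\<close>, the least
  colour and the place where it occurs would be a forbidden labelling.\<close>

lemma (in cyclic_action) compatibility_colouring_bound:
  assumes "reflp R" and acyc: "acyclic_upto U R d U"
    and c: "\<And>x. x \<in> U \<Longrightarrow> c x < m"
    and proper: "\<And>x y i. x \<in> U \<Longrightarrow> y \<in> U \<Longrightarrow> 0 < i \<Longrightarrow> i < r \<Longrightarrow> R x ((\<gamma> ^^ i) y) \<Longrightarrow> c x \<noteq> c y"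
  shows "d + r \<le> m"
proof (rule ccontr)
  assume less: "\<not> d + r \<le> m"
  \<comment> \<open>Undoing the shift by \<open>p\<close> leaves \<open>x\<close> comparable with a
    translate of \<open>y\<close> of the same colour; properness permits only the trivial
    translate.\<close>
  have key: "p mod r = q mod r"
    if "x \<in> U" "y \<in> U" "c x = c y" "R ((\<gamma> ^^ p) x) ((\<gamma> ^^ q) y)" for x y p q
  proof -
    define i where "i = (r * p - p + q) mod r"
    have "R x ((\<gamma> ^^ (r * p - p)) ((\<gamma> ^^ q) y))"
      using R_funpow[OF that(4), of "r * p - p"] by (simp add: funpow_inverse)
    then have "R x ((\<gamma> ^^ i) y)" unfolding i_def funpow_mod_period by (simp add: funpow_add)
    then have "i = 0" using proper[OF that(1,2), of i] that(3) r_ge_2 by (auto simp: i_def)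
    then have "(p + (r * p - p + q)) mod r = p mod r" unfolding i_def by (metis add.right_neutral mod_add_right_eq)
    moreover have "p \<le> r * p" using r_ge_2 by simp
    then have "p + (r * p - p + q) = r * p + q" by linarith
    ultimately show ?thesis by simp
  qed
  define C where "C = (\<lambda>x. range (\<lambda>i. c ((\<gamma> ^^ i) x)))"
  have C: "C x = (\<lambda>i. c ((\<gamma> ^^ i) x)) ` {..<r}" for x
  proof -
    have "c ((\<gamma> ^^ i) x) \<in> (\<lambda>i. c ((\<gamma> ^^ i) x)) ` {..<r}" for i
      by (rule image_eqI[of _ _ "i mod r"]) (use r_ge_2 in \<open>auto simp: funpow_mod_period\<close>)
    then show ?thesis unfolding C_def by blast
  qed
  have finC: "finite (C x)" "C x \<noteq> {}" for x by (simp add: C) (simp add: C_def)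
  have C\<gamma>: "C (\<gamma> x) = C x" for x
  proof -
    have "c ((\<gamma> ^^ i) (\<gamma> x)) \<in> C x" for i
      unfolding C_def by (rule range_eqI[of _ _ "Suc i"]) (simp only: funpow_Suc_right comp_apply)
    moreover have "c ((\<gamma> ^^ i) x) \<in> C (\<gamma> x)" for i
    proof (unfold C_def, rule range_eqI[of _ _ "i + (r - 1)"])
      have "(\<gamma> ^^ (i + (r - 1))) (\<gamma> x) = (\<gamma> ^^ (Suc (i + (r - 1)))) x"
        by (simp only: funpow_Suc_right comp_apply)
      also have "Suc (i + (r - 1)) = i + r" using r_ge_2 by simp
      finally show "c ((\<gamma> ^^ i) x) = c ((\<gamma> ^^ (i + (r - 1))) (\<gamma> x))"
        by (simp add: funpow_add period)
    qed
    ultimately show ?thesis unfolding C_def by blast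
  qed
  define a where "a = (\<lambda>x. Min (C x))"
  \<comment> \<open>The least colour occurs at the translate by \<open>r - t\<close>; counting
    backwards makes \<open>s\<close> increase by one under \<open>\<gamma>\<close>.\<close>
  define s where "s = (\<lambda>x. SOME t. t < r \<and> c ((\<gamma> ^^ (r - t)) x) = a x)"
  have s: "s x < r \<and> c ((\<gamma> ^^ (r - s x)) x) = a x" for x
  proof -
    have "a x \<in> C x" unfolding a_def using finC by simp
    then obtain i where i: "i < r" "c ((\<gamma> ^^ i) x) = a x" by (auto simp: C)
    \<comment> \<open>The reduction sends \<open>i = 0\<close> to \<open>t = 0\<close>, whose
      exponent \<open>r\<close> is a full period.\<close>
    have "(r - i) mod r < r \<and> c ((\<gamma> ^^ (r - (r - i) mod r)) x) = a x"
      using i r_ge_2 by (cases "i = 0") (auto simp: period)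
    then show ?thesis unfolding s_def by (rule someI)
  qed
  have s_back: "(\<gamma> ^^ s x) ((\<gamma> ^^ (r - s x)) y) = y" for x y
    using s[of x] period[of y] by (metis comp_apply funpow_add le_add_diff_inverse less_imp_le)
  show False
  proof (rule no_equivariant_labelling[OF acyc, of a s])
    fix x assume x: "x \<in> U"
    have "inj_on (\<lambda>i. c ((\<gamma> ^^ i) x)) {..<r}"
    proof (rule inj_onI)
      fix i j assume ij: "i \<in> {..<r}" "j \<in> {..<r}" "c ((\<gamma> ^^ i) x) = c ((\<gamma> ^^ j) x)"
      have "(\<gamma> ^^ j) ((\<gamma> ^^ i) x) = (\<gamma> ^^ i) ((\<gamma> ^^ j) x)"
        by (metis add.commute comp_apply funpow_add)
      then have "R ((\<gamma> ^^ j) ((\<gamma> ^^ i) x)) ((\<gamma> ^^ i) ((\<gamma> ^^ j) x))"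
        using assms(1) by (simp add: reflpD)
      from key[OF funpow_closed[OF x] funpow_closed[OF x] ij(3) this] show "i = j" using ij by simp
    qed
    then have "card (C x) = r" by (simp add: C card_image)
    moreover have "C x \<subseteq> {a x..<m}"
      using c funpow_closed[OF x] finC by (auto simp: a_def) (auto simp: C_def)
    then have "card (C x) \<le> m - a x" using card_mono[of "{a x..<m}" "C x"] by simp
    moreover have "a x < m" using c[OF funpow_closed[OF x]] s by metis
    ultimately show "a x < d" using less by linarith
    show "a (\<gamma> x) = a x" by (simp add: a_def C\<gamma>)
    show "s x < r" using s by simp
    have "c ((\<gamma> ^^ (r - s x)) x) = c ((\<gamma> ^^ (r - s (\<gamma> x))) (\<gamma> x))"
      using s \<open>a (\<gamma> x) = a x\<close> by metis
    moreover have "(\<gamma> ^^ Suc (s x)) ((\<gamma> ^^ (r - s x)) x) = (\<gamma> ^^ s (\<gamma> x)) ((\<gamma> ^^ (r - s (\<gamma> x))) (\<gamma> x))"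
      by (simp add: s_back)
    then have "R ((\<gamma> ^^ Suc (s x)) ((\<gamma> ^^ (r - s x)) x)) ((\<gamma> ^^ s (\<gamma> x)) ((\<gamma> ^^ (r - s (\<gamma> x))) (\<gamma> x)))"
      using assms(1) by (metis reflpD)
    ultimately have "Suc (s x) mod r = s (\<gamma> x) mod r"
      by (intro key[OF funpow_closed[OF x] funpow_closed[OF closed[OF x]]])
    then show "s (\<gamma> x) = Suc (s x) mod r" using s[of "\<gamma> x"] by simp
  next
    fix x y assume xy: "x \<in> U" "y \<in> U" "R x y" "a x = a y"
    have "c ((\<gamma> ^^ (r - s x)) x) = c ((\<gamma> ^^ (r - s y)) y)" using s xy(4) by metis
    moreover have "R ((\<gamma> ^^ s x) ((\<gamma> ^^ (r - s x)) x)) ((\<gamma> ^^ s y) ((\<gamma> ^^ (r - s y)) y))"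
      using xy(3) by (simp add: s_back)
    ultimately have "s x mod r = s y mod r"
      by (intro key[OF funpow_closed[OF xy(1)] funpow_closed[OF xy(2)]])
    then show "s x = s y" using s by simp
  qed
qed

section \<open>Partial colourings\<close>

text \<open>Outside \<open>N\<close> the colouring is prescribed by \<open>b\<close>. Thus fixing the colour of a vertex of \<open>N\<close> leads
  literally to a set of the same form, which is what the induction on \<open>N\<close> needs.\<close>

definition partial_colourings ::
    "'v set \<Rightarrow> 'c set \<Rightarrow> ('c \<Rightarrow> nat) \<Rightarrow> ('v \<rightharpoonup> 'c) \<Rightarrow> ('v \<rightharpoonup> 'c) set" where
  "partial_colourings N J \<kappa> b = {x. (\<forall>i. i \<notin> N \<longrightarrow> x i = b i) \<and>
     (\<forall>i\<in>N. x i \<in> insert None (Some ` J)) \<and> (\<forall>j\<in>J. \<kappa> j \<le> card {i \<in> N. x i = Some j})}"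

definition map_comparable :: "('v \<rightharpoonup> 'c) \<Rightarrow> ('v \<rightharpoonup> 'c) \<Rightarrow> bool" where
  "map_comparable x y \<longleftrightarrow> x \<subseteq>\<^sub>m y \<or> y \<subseteq>\<^sub>m x"

lemma map_le_order: "reflp (\<subseteq>\<^sub>m)" "transp (\<subseteq>\<^sub>m)" "antisymp (\<subseteq>\<^sub>m)"
  by (auto intro: reflpI transpI antisympI map_le_trans map_le_antisym)

lemma reflp_map_comparable: "reflp map_comparable"
  by (simp add: reflp_def map_comparable_def)

lemma map_leD: "x \<subseteq>\<^sub>m y \<Longrightarrow> x i = Some c \<Longrightarrow> y i = Some c"
  by (metis domI map_le_def)

lemma map_leI: "(\<And>i c. x i = Some c \<Longrightarrow> y i = Some c) \<Longrightarrow> x \<subseteq>\<^sub>m y"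
  by (auto simp: map_le_def)

lemma card_class_insert:
  assumes "finite N" "n \<notin> N"
  shows "card {i \<in> insert n N. x i = Some j} = card {i \<in> N. x i = Some j} + (if x n = Some j then 1 else 0)"
proof (cases "x n = Some j")
  case True
  then have "{i \<in> insert n N. x i = Some j} = insert n {i \<in> N. x i = Some j}" by auto
  then show ?thesis using True assms by simp
next
  case False
  then have "{i \<in> insert n N. x i = Some j} = {i \<in> N. x i = Some j}" by auto
  then show ?thesis using False by simp
qed

lemma partial_colourings_fix_Some:
  assumes N: "finite N" "n \<notin> N" and j: "j \<in> J" "0 < \<kappa> j"
  shows "{x \<in> partial_colourings (insert n N) J \<kappa> b. x n = Some j}
    = partial_colourings N J (\<kappa>(j := \<kappa> j - 1)) (b(n \<mapsto> j))" (is "?L = ?R")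
proof (rule Set.set_eqI)
  fix x
  show "x \<in> ?L \<longleftrightarrow> x \<in> ?R"
  proof (cases "x n = Some j")
    case True
    have "(\<forall>c\<in>J. \<kappa> c \<le> card {i \<in> insert n N. x i = Some c})
        \<longleftrightarrow> (\<forall>c\<in>J. (\<kappa>(j := \<kappa> j - 1)) c \<le> card {i \<in> N. x i = Some c})"
      unfolding card_class_insert[OF N] using True j by (intro ball_cong refl) auto
    then show ?thesis using True N(2) j(1) by (auto simp: partial_colourings_def)
  next
    case False
    then show ?thesis using N(2) by (auto simp: partial_colourings_def)
  qed
qed

lemma partial_colourings_fix_None:
  assumes N: "finite N" "n \<notin> N"
  shows "{x \<in> partial_colourings (insert n N) J \<kappa> b. x n = None}
    = partial_colourings N J \<kappa> (b(n := None))" (is "?L = ?R")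
proof (rule Set.set_eqI)
  fix x
  show "x \<in> ?L \<longleftrightarrow> x \<in> ?R"
  proof (cases "x n = None")
    case True
    have "(\<forall>c\<in>J. \<kappa> c \<le> card {i \<in> insert n N. x i = Some c})
        \<longleftrightarrow> (\<forall>c\<in>J. \<kappa> c \<le> card {i \<in> N. x i = Some c})"
      unfolding card_class_insert[OF N] using True by simp
    then show ?thesis using True N(2) by (auto simp: partial_colourings_def)
  next
    case False
    then show ?thesis using N(2) by (auto simp: partial_colourings_def)
  qed
qed

lemma partial_colourings_positive_subset:
  "partial_colourings N {j \<in> J. 0 < \<kappa> j} \<kappa> b \<subseteq> partial_colourings N J \<kappa> b"
proof
  fix x assume x: "x \<in> partial_colourings N {j \<in> J. 0 < \<kappa> j} \<kappa> b"
  have "\<kappa> j \<le> card {i \<in> N. x i = Some j}" if "j \<in> J" for j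
    using x that by (cases "\<kappa> j = 0") (auto simp: partial_colourings_def)
  then show "x \<in> partial_colourings N J \<kappa> b" using x by (auto simp: partial_colourings_def)
qed

text \<open>Erasing every colour without a demand is a decreasing retraction, so the retract lemma
  is applied to the reversed order. It leaves only colours whose demand can still be
  lowered.\<close>

lemma acyclic_upto_partial_colourings_positive:
  assumes "finite U" "partial_colourings N J \<kappa> b \<subseteq> U"
    and "acyclic_upto U map_comparable l (partial_colourings N {j \<in> J. 0 < \<kappa> j} \<kappa> b)"
  shows "acyclic_upto U map_comparable l (partial_colourings N J \<kappa> b)"
proof -
  define f where
    "f = (\<lambda>x i. if i \<in> N \<and> x i \<notin> Some ` {j \<in> J. 0 < \<kappa> j} then None else x i :: 'b option)"
  have class_f: "{i \<in> N. f x i = Some j} = {i \<in> N. x i = Some j}" if "j \<in> J" "0 < \<kappa> j" for x j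
    using that by (auto simp: f_def)
  have f_le: "f x \<subseteq>\<^sub>m x" for x by (auto simp: f_def map_le_def)
  have fixed: "{x \<in> partial_colourings N J \<kappa> b. f x = x} = partial_colourings N {j \<in> J. 0 < \<kappa> j} \<kappa> b"
  proof (intro equalityI subsetI)
    fix x assume "x \<in> {x \<in> partial_colourings N J \<kappa> b. f x = x}"
    then have x: "x \<in> partial_colourings N J \<kappa> b" "f x = x" by auto
    have "x i \<in> insert None (Some ` {j \<in> J. 0 < \<kappa> j})" if "i \<in> N" for i
      using that fun_cong[OF x(2), of i] by (auto simp: f_def split: if_splits)
    then show "x \<in> partial_colourings N {j \<in> J. 0 < \<kappa> j} \<kappa> b"
      using x(1) unfolding partial_colourings_def by blast
  next
    fix x assume x: "x \<in> partial_colourings N {j \<in> J. 0 < \<kappa> j} \<kappa> b"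
    have "f x = x" using x by (auto simp: f_def partial_colourings_def fun_eq_iff)
    moreover have "x \<in> partial_colourings N J \<kappa> b"
      using x partial_colourings_positive_subset by blast
    ultimately show "x \<in> {x \<in> partial_colourings N J \<kappa> b. f x = x}" by simp
  qed
  show ?thesis
  proof (rule acyclic_upto_retract[OF assms(1,2), where le = "\<lambda>x y. y \<subseteq>\<^sub>m x" and f = f])
    show "reflp (\<lambda>x y :: 'a \<rightharpoonup> 'b. y \<subseteq>\<^sub>m x)" "transp (\<lambda>x y :: 'a \<rightharpoonup> 'b. y \<subseteq>\<^sub>m x)"
      "antisymp (\<lambda>x y :: 'a \<rightharpoonup> 'b. y \<subseteq>\<^sub>m x)"
      using map_le_order by (auto intro: reflpI transpI antisympI map_le_trans map_le_antisym)
    show "map_comparable x y \<longleftrightarrow> y \<subseteq>\<^sub>m x \<or> x \<subseteq>\<^sub>m y" for x y :: "'a \<rightharpoonup> 'b"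
      by (auto simp: map_comparable_def)
    show "f x \<in> partial_colourings N J \<kappa> b" if x: "x \<in> partial_colourings N J \<kappa> b" for x
    proof -
      have "\<kappa> j \<le> card {i \<in> N. f x i = Some j}" if "j \<in> J" for j
        using x that class_f[OF that] by (cases "\<kappa> j = 0") (auto simp: partial_colourings_def)
      then show ?thesis using x by (auto simp: partial_colourings_def f_def)
    qed
    show "f (f x) = f x" for x by (auto simp: f_def)
    show "f x \<subseteq>\<^sub>m x" for x by (rule f_le)
    show "f y \<subseteq>\<^sub>m f x" if "y \<subseteq>\<^sub>m x" for x y
      using map_leD[OF that] by (intro map_leI) (auto simp: f_def split: if_splits)
    show "acyclic_upto U map_comparable l {x \<in> partial_colourings N J \<kappa> b. f x = x}"
      unfolding fixed by (rule assms(3))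
  qed
qed

text \<open>Colouring \<open>n\<close> by \<open>j\<close> lowers the demand and the number of free
  vertices by one each. Leaving \<open>n\<close> uncoloured only loses a vertex, and the one degree
  lost is what Mayer--Vietoris allows on intersections.\<close>

lemma acyclic_upto_partial_colourings:
  assumes "finite U" "finite N" "finite J" "sum \<kappa> J + l \<le> card N" "partial_colourings N J \<kappa> b \<subseteq> U"
  shows "acyclic_upto U map_comparable l (partial_colourings N J \<kappa> b)"
  using assms(2-)
proof (induction N arbitrary: J \<kappa> b l rule: finite_induct)
  case empty
  then have J: "{j \<in> J. 0 < \<kappa> j} = {}" by auto
  have P: "partial_colourings {} {} \<kappa> b = {b}" by (auto simp: partial_colourings_def)
  have "b \<in> partial_colourings {} J \<kappa> b" using empty by (auto simp: partial_colourings_def)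
  then have "acyclic_upto U map_comparable l {b}"
    using acyclic_upto_singleton[OF assms(1)] empty.prems(3) reflp_map_comparable
    by (metis reflpD subsetD)
  then show ?case
    by (intro acyclic_upto_partial_colourings_positive[OF assms(1) empty.prems(3)]) (simp only: J P)
next
  case (insert n N)
  define J' where "J' = {j \<in> J. 0 < \<kappa> j}"
  have J': "finite J'" using insert.prems(1) by (simp add: J'_def)
  have "sum \<kappa> J' \<le> sum \<kappa> J" using insert.prems(1) by (intro sum_mono2) (auto simp: J'_def)
  then have sum: "sum \<kappa> J' + l \<le> Suc (card N)" using insert.prems(2) insert.hyps by simp
  let ?P = "partial_colourings (insert n N) J' \<kappa> b"
  have sub: "?P \<subseteq> U"
    using partial_colourings_positive_subset insert.prems(3) unfolding J'_def by (rule order_trans)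
  have "acyclic_upto U map_comparable l ?P"
  \<comment> \<open>Without colours only the colouring that is empty on \<open>insert n N\<close>
    remains, a single point.\<close>
  proof (cases "J' = {}")
    case True
    define c where "c = (\<lambda>i. if i \<in> insert n N then None else b i)"
    have P: "?P = {c}" unfolding True by (auto simp: partial_colourings_def c_def fun_eq_iff)
    then have "c \<in> U" using sub by simp
    then show ?thesis unfolding P using reflp_map_comparable
      by (intro acyclic_upto_singleton[OF assms(1)]) (auto dest: reflpD)
  next
    case False
    \<comment> \<open>Giving \<open>n\<close> the colour \<open>j\<close> retracts this piece onto
      the colourings with \<open>x n = Some j\<close>. The pieces cover \<open>?P\<close>.\<close>
    define V where "V = (\<lambda>j. {x \<in> ?P. x n = None \<or> x n = Some j})"
    have V: "acyclic_upto U map_comparable l (V j)" if j: "j \<in> J'" for j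
    proof (rule acyclic_upto_retract[OF assms(1) _ map_le_order, where f = "\<lambda>x. x(n \<mapsto> j)"])
      show "V j \<subseteq> U" using sub by (auto simp: V_def)
      show "map_comparable x y \<longleftrightarrow> x \<subseteq>\<^sub>m y \<or> y \<subseteq>\<^sub>m x" for x y :: "'a \<rightharpoonup> 'b"
        by (simp add: map_comparable_def)
      show "x(n \<mapsto> j) \<in> V j" if x: "x \<in> V j" for x
      proof -
        have class_sub: "{i \<in> insert n N. x i = Some c} \<subseteq> {i \<in> insert n N. (x(n \<mapsto> j)) i = Some c}" for c
          using x by (auto simp: V_def)
        have "\<kappa> c \<le> card {i \<in> insert n N. (x(n \<mapsto> j)) i = Some c}" if "c \<in> J'" for c
        proof -
          have "\<kappa> c \<le> card {i \<in> insert n N. x i = Some c}"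
            using x that unfolding V_def partial_colourings_def by blast
          also have "\<dots> \<le> card {i \<in> insert n N. (x(n \<mapsto> j)) i = Some c}"
            by (rule card_mono[OF _ class_sub]) (use insert.hyps in simp)
          finally show ?thesis .
        qed
        moreover have "\<forall>i. i \<notin> insert n N \<longrightarrow> (x(n \<mapsto> j)) i = b i"
          "\<forall>i\<in>insert n N. (x(n \<mapsto> j)) i \<in> insert None (Some ` J')"
          using x j by (auto simp: V_def partial_colourings_def)
        ultimately have "x(n \<mapsto> j) \<in> ?P" unfolding partial_colourings_def by blast
        then show ?thesis by (simp add: V_def)
      qed
      show "(x(n \<mapsto> j))(n \<mapsto> j) = x(n \<mapsto> j)" for x by simp
      show "x \<subseteq>\<^sub>m x(n \<mapsto> j)" if "x \<in> V j" for x
        using that by (auto simp: V_def intro!: map_leI)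
      show "x(n \<mapsto> j) \<subseteq>\<^sub>m y(n \<mapsto> j)" if "x \<subseteq>\<^sub>m y" for x y
        using map_leD[OF that] by (auto intro!: map_leI split: if_splits)
      have "{x \<in> V j. x(n \<mapsto> j) = x} = {x \<in> ?P. x n = Some j}"
        by (auto simp: V_def fun_eq_iff split: if_splits)
      also have eq: "\<dots> = partial_colourings N J' (\<kappa>(j := \<kappa> j - 1)) (b(n \<mapsto> j))"
        by (rule partial_colourings_fix_Some[OF insert.hyps j]) (use j in \<open>simp add: J'_def\<close>)
      finally show "acyclic_upto U map_comparable l {x \<in> V j. x(n \<mapsto> j) = x}"
      proof (rule ssubst, intro insert.IH[OF J'])
        have "sum (\<kappa>(j := \<kappa> j - 1)) (J' - {j}) = sum \<kappa> (J' - {j})"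
          by (rule sum.cong) auto
        moreover have "0 < \<kappa> j" using j by (simp add: J'_def)
        ultimately have "sum (\<kappa>(j := \<kappa> j - 1)) J' + 1 = sum \<kappa> J'"
          unfolding sum.remove[OF J' j, of \<kappa>] sum.remove[OF J' j, of "\<kappa>(j := \<kappa> j - 1)"]
          by simp
        then show "sum (\<kappa>(j := \<kappa> j - 1)) J' + l \<le> card N" using sum by simp
        show "partial_colourings N J' (\<kappa>(j := \<kappa> j - 1)) (b(n \<mapsto> j)) \<subseteq> U"
          using sub unfolding eq[symmetric] by blast
      qed
    qed
    have V0: "acyclic_upto U map_comparable m {x \<in> ?P. x n = None}" if "l = Suc m" for m
    proof -
      note eq = partial_colourings_fix_None[OF insert.hyps, of J' \<kappa> b]
      have "partial_colourings N J' \<kappa> (b(n := None)) \<subseteq> U" using sub unfolding eq[symmetric] by blast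
      moreover have "sum \<kappa> J' + m \<le> card N" using sum that by simp
      ultimately show ?thesis unfolding eq by (intro insert.IH[OF J'])
    qed
    have "acyclic_upto U map_comparable l (\<Union>j\<in>I. V j)" if "finite I" "I \<noteq> {}" "I \<subseteq> J'" for I
      using that
    proof (induction I rule: finite_ne_induct)
      case (singleton j)
      then show ?case using V by simp
    next
      case (insert j I)
      have "acyclic_upto U map_comparable l ((\<Union>j\<in>I. V j) \<union> V j)"
      proof (rule acyclic_upto_Un)
        show "acyclic_upto U map_comparable l (\<Union>j\<in>I. V j)" "acyclic_upto U map_comparable l (V j)"
          using insert V by simp_all
        \<comment> \<open>As \<open>j\<close> is not in \<open>I\<close>, a common element cannot
          have \<open>n\<close> coloured; elements giving \<open>n\<close> two different colours are
          incomparable.\<close>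
        have "(\<Union>j\<in>I. V j) \<inter> V j = {x \<in> ?P. x n = None}"
          using insert.hyps by (auto simp: V_def)
        then show "acyclic_upto U map_comparable m ((\<Union>j\<in>I. V j) \<inter> V j)" if "l = Suc m" for m
          using V0[OF that] by simp
        fix x y assume xy: "x \<in> (\<Union>j\<in>I. V j) - V j" "y \<in> V j - (\<Union>j\<in>I. V j)"
        then obtain i where i: "i \<in> I" "x n = Some i" by (auto simp: V_def)
        have y: "y n = Some j" using xy(2) insert.hyps by (auto simp: V_def)
        have "i \<noteq> j" using i insert.hyps by blast
        then show "\<not> map_comparable x y"
          using i y map_leD[of x y n i] map_leD[of y x n j] by (auto simp: map_comparable_def)
      qed
      then show ?case by (simp add: Un_commute)
    qed
    from this[OF J' False order_refl] have "acyclic_upto U map_comparable l (\<Union>j\<in>J'. V j)" .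
    moreover have "(\<Union>j\<in>J'. V j) = ?P"
      using False by (auto simp: V_def partial_colourings_def)
    ultimately show ?thesis by simp
  qed
  then show ?case
    unfolding J'_def by (rule acyclic_upto_partial_colourings_positive[OF assms(1) insert.prems(3)])
qed

lemma finite_partial_colourings:
  assumes "finite N" "finite J"
  shows "finite (partial_colourings N J \<kappa> Map.empty)"
proof (rule finite_subset)
  show "partial_colourings N J \<kappa> Map.empty
      \<subseteq> {x. \<forall>i. (i \<in> N \<longrightarrow> x i \<in> insert None (Some ` J)) \<and> (i \<notin> N \<longrightarrow> x i = None)}"
    by (auto simp: partial_colourings_def)
  show "finite {x. \<forall>i. (i \<in> N \<longrightarrow> x i \<in> insert None (Some ` J)) \<and> (i \<notin> N \<longrightarrow> x i = None)}"
    by (rule finite_set_of_finite_funs) (use assms in auto)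
qed

section \<open>The comparison with the Hom poset\<close>

text \<open>The class at position \<open>j\<close> of the shifted tuple is the old class
  \<open>j + 1\<close>, so colours move down by one. The offset \<open>2\<close> is this step plus
  the passage to residues from \<open>0\<close>; values outside \<open>{1..r}\<close> are fixed to
  keep the period global.\<close>

definition cyclic_pred :: "nat \<Rightarrow> nat \<Rightarrow> nat" where
  "cyclic_pred r j = (if j \<in> {1..r} then nat ((int j - 2) mod int r) + 1 else j)"

lemma cyclic_pred_funpow:
  assumes "r \<ge> 1"
  shows "(cyclic_pred r ^^ i) j = (if j \<in> {1..r} then nat ((int j - 1 - int i) mod int r) + 1 else j)"
proof (induction i)
  case 0
  then show ?case by (auto simp: nat_diff_distrib)
next
  case (Suc i)
  show ?case
  proof (cases "j \<in> {1..r}")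
    case True
    let ?m = "nat ((int j - 1 - int i) mod int r) + 1"
    have m: "?m \<in> {1..r}" by (rule cyclic_shift_index[OF assms])
    have "(int ?m - 2) mod int r
        = ((int j - 1 - int i) mod int r - 1) mod int r"
      using assms by simp
    also have "\<dots> = (int j - 1 - int (Suc i)) mod int r" by (simp add: mod_simps algebra_simps)
    finally have "cyclic_pred r ?m = nat ((int j - 1 - int (Suc i)) mod int r) + 1"
      using m by (simp only: cyclic_pred_def if_True)
    then show ?thesis using True Suc by simp
  next
    case False
    then have "cyclic_pred r j = j" by (simp only: cyclic_pred_def if_False)
    moreover have "(cyclic_pred r ^^ i) j = j" using False Suc by (simp only: if_False)
    ultimately show ?thesis using False by (simp only: funpow.simps(2) comp_apply if_False)
  qed
qed

lemma cyclic_pred_eq_iff: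
  assumes "j \<in> {1..r}" "j' \<in> {1..r}"
  shows "cyclic_pred r j' = j \<longleftrightarrow> j' = j mod r + 1"
proof -
  have "cyclic_pred r j' = (if j' = 1 then r else j' - 1)"
  proof (cases "j' = 1")
    case True
    have "(-1) mod int r = int r - 1" using assms by (simp add: zmod_minus1)
    then show ?thesis using True assms by (simp add: cyclic_pred_def nat_diff_distrib)
  next
    case False
    then have "(int j' - 2) mod int r = int j' - 2" using assms by simp
    then show ?thesis using False assms by (auto simp: cyclic_pred_def)
  qed
  moreover have "j mod r + 1 = (if j = r then 1 else j + 1)" using assms by auto
  ultimately show ?thesis using assms by auto
qed

definition rotate_colours :: "nat \<Rightarrow> ('v \<rightharpoonup> nat) \<Rightarrow> ('v \<rightharpoonup> nat)" where
  "rotate_colours r x = map_option (cyclic_pred r) \<circ> x"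

lemma rotate_colours_funpow:
  "(rotate_colours r ^^ i) x = map_option (cyclic_pred r ^^ i) \<circ> x"
proof (induction i)
  case 0
  show ?case by (simp add: fun_eq_iff option.map_id option.map_ident)
next
  case (Suc i)
  have "(rotate_colours r ^^ Suc i) x = rotate_colours r (map_option (cyclic_pred r ^^ i) \<circ> x)"
    by (simp only: funpow.simps(2) comp_apply[of "rotate_colours r"] Suc)
  also have "\<dots> = map_option (cyclic_pred r) \<circ> (map_option (cyclic_pred r ^^ i) \<circ> x)"
    by (rule rotate_colours_def)
  finally show ?case by (simp add: fun_eq_iff option.map_comp comp_def)
qed

lemma rotate_colours_class:
  assumes "x \<in> partial_colourings N {1..r} \<kappa> b" "j \<in> {1..r}"
  shows "{i \<in> N. rotate_colours r x i = Some j} = {i \<in> N. x i = Some (j mod r + 1)}"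
proof -
  have "rotate_colours r x i = Some j \<longleftrightarrow> x i = Some (j mod r + 1)" if "i \<in> N" for i
  proof (cases "x i")
    case (Some j')
    then have "j' \<in> {1..r}" using assms(1) that by (force simp: partial_colourings_def)
    then show ?thesis using Some cyclic_pred_eq_iff[OF assms(2)] by (simp add: rotate_colours_def)
  qed (simp add: rotate_colours_def)
  then show ?thesis by auto
qed

lemma cyclic_action_rotate_colours:
  assumes "r \<ge> 2" "finite N"
  shows "cyclic_action (partial_colourings N {1..r} (\<lambda>_. k) Map.empty) map_comparable (rotate_colours r) r"
proof
  show "finite (partial_colourings N {1..r} (\<lambda>_. k) Map.empty)"
    by (rule finite_partial_colourings) (use assms in auto)
  show "2 \<le> r" by (rule assms)
  show "(rotate_colours r ^^ r) x = x" for x :: "'a \<rightharpoonup> nat"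
  proof -
    have "(cyclic_pred r ^^ r) j = j" for j
    proof (cases "j \<in> {1..r}")
      case True
      then have "(int j - 1 - int r) mod int r = int j - 1" by simp
      moreover have "nat (int j - 1) + 1 = j" using True by auto
      ultimately have "nat ((int j - 1 - int r) mod int r) + 1 = j" by simp
      then show ?thesis using True assms(1) by (simp only: cyclic_pred_funpow if_True)
    next
      case False
      then show ?thesis using assms(1) by (simp only: cyclic_pred_funpow if_False)
    qed
    then have "cyclic_pred r ^^ r = id" by auto
    then show ?thesis by (simp only: rotate_colours_funpow option.map_id0 id_comp)
  qed
  show "rotate_colours r x \<in> partial_colourings N {1..r} (\<lambda>_. k) Map.empty"
    if x: "x \<in> partial_colourings N {1..r} (\<lambda>_. k) Map.empty" for x
  proof -
    have "k \<le> card {i \<in> N. rotate_colours r x i = Some j}" if j: "j \<in> {1..r}" for j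
    proof -
      have "j mod r + 1 \<in> {1..r}" using assms(1) by (simp add: Suc_leI)
      then show ?thesis unfolding rotate_colours_class[OF x j]
        using x unfolding partial_colourings_def by blast
    qed
    moreover have "rotate_colours r x i \<in> insert None (Some ` {1..r})" if "i \<in> N" for i
    proof (cases "x i")
      case (Some j)
      have "cyclic_pred r j \<in> {1..r}" if "j \<in> {1..r}"
        using that cyclic_shift_index[of r "int j - 2"] assms(1) by (simp add: cyclic_pred_def)
      moreover have "j \<in> {1..r}" using Some x that by (force simp: partial_colourings_def)
      ultimately show ?thesis using Some by (simp add: rotate_colours_def)
    qed (simp add: rotate_colours_def)
    moreover have "rotate_colours r x i = None" if "i \<notin> N" for i
      using x that by (simp add: partial_colourings_def rotate_colours_def)
    ultimately show ?thesis unfolding partial_colourings_def by blast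
  qed
  have "rotate_colours r x \<subseteq>\<^sub>m rotate_colours r y" if "x \<subseteq>\<^sub>m y" for x y :: "'a \<rightharpoonup> nat"
    using map_leD[OF that] by (intro map_leI) (auto simp: rotate_colours_def)
  then show "map_comparable (rotate_colours r x) (rotate_colours r y)"
    if "map_comparable x y" for x y :: "'a \<rightharpoonup> nat"
    using that unfolding map_comparable_def by blast
qed

definition kneser_tuple :: "nat \<Rightarrow> nat \<Rightarrow> nat \<Rightarrow> (nat \<rightharpoonup> nat) \<Rightarrow> nat \<Rightarrow> nat set set" where
  "kneser_tuple n k r x = (\<lambda>j\<in>{1..r}. {B. B \<subseteq> {i \<in> {1..n}. x i = Some j} \<and> card B = k})"

text \<open>The demand \<open>k\<close> makes every entry non-empty, and disjointness of colour
  classes makes distinct entries completely adjacent.\<close>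

lemma kneser_tuple_in_hom_poset:
  assumes x: "x \<in> partial_colourings {1..n} {1..r} (\<lambda>_. k) b"
  shows "kneser_tuple n k r x \<in> carrier (hom_poset r (kneser_graph n k))"
proof -
  have "\<exists>B. B \<subseteq> {i \<in> {1..n}. x i = Some j} \<and> card B = k" if "j \<in> {1..r}" for j
  proof -
    have "k \<le> card {i \<in> {1..n}. x i = Some j}" using x that unfolding partial_colourings_def by blast
    then show ?thesis by (meson obtain_subset_with_card_n)
  qed
  then have "{B. B \<subseteq> {i \<in> {1..n}. x i = Some j} \<and> card B = k}
      \<in> {X. X \<subseteq> pverts (kneser_graph n k) \<and> X \<noteq> {}}" if "j \<in> {1..r}" for j
    using that unfolding kneser_graph_def by auto
  then have "kneser_tuple n k r x \<in> {1..r} \<rightarrow>\<^sub>E {X. X \<subseteq> pverts (kneser_graph n k) \<and> X \<noteq> {}}"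
    unfolding kneser_tuple_def restrict_PiE_iff by blast
  moreover have "kneser_tuple n k r x i \<times> kneser_tuple n k r x j \<subseteq> parcs (kneser_graph n k)"
    if "i \<in> {1..r}" "j \<in> {1..r}" "i \<noteq> j" for i j
  proof -
    have "A \<inter> B = {}" if "A \<subseteq> {v \<in> {1..n}. x v = Some i}" "B \<subseteq> {v \<in> {1..n}. x v = Some j}" for A B
      using that \<open>i \<noteq> j\<close> by fastforce
    then show ?thesis using that(1,2) by (auto simp: kneser_tuple_def kneser_graph_def)
  qed
  ultimately show ?thesis by (simp add: hom_poset_def)
qed

lemma kneser_tuple_mono:
  assumes "x \<subseteq>\<^sub>m y"
  shows "kneser_tuple n k r x \<sqsubseteq>\<^bsub>hom_poset r (kneser_graph n k)\<^esub> kneser_tuple n k r y"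
proof -
  have "{i \<in> {1..n}. x i = Some j} \<subseteq> {i \<in> {1..n}. y i = Some j}" for j
    using map_leD[OF assms] by blast
  then have "{B. B \<subseteq> {i \<in> {1..n}. x i = Some j} \<and> card B = k}
      \<subseteq> {B. B \<subseteq> {i \<in> {1..n}. y i = Some j} \<and> card B = k}" for j
    using subset_trans by blast
  then show ?thesis by (simp add: hom_poset_def kneser_tuple_def)
qed

lemma kneser_tuple_rotate_colours:
  assumes "r \<ge> 1" and x: "x \<in> partial_colourings {1..n} {1..r} (\<lambda>_. k) b"
  shows "kneser_tuple n k r (rotate_colours r x)
    = cyclic_shift r (kneser_graph n k) 1 (kneser_tuple n k r x)"
proof
  fix j
  show "kneser_tuple n k r (rotate_colours r x) j
    = cyclic_shift r (kneser_graph n k) 1 (kneser_tuple n k r x) j"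
  proof (cases "j \<in> {1..r}")
    case True
    have idx: "nat ((int j + 1 - 1) mod int r) + 1 = j mod r + 1"
      by (simp add: nat_mod_distrib)
    have "j mod r + 1 \<in> {1..r}" using assms(1) by (simp add: Suc_leI)
    moreover have "cyclic_shift r (kneser_graph n k) 1 (kneser_tuple n k r x) j
        = kneser_tuple n k r x (j mod r + 1)"
      unfolding cyclic_shift_def restrict_apply'[OF kneser_tuple_in_hom_poset[OF x]]
        restrict_apply'[OF True] idx ..
    ultimately show ?thesis
      using True by (simp only: kneser_tuple_def restrict_apply' rotate_colours_class[OF x True])
  next
    case False
    then show ?thesis
      unfolding cyclic_shift_def restrict_apply'[OF kneser_tuple_in_hom_poset[OF x]]
      by (simp only: kneser_tuple_def restrict_apply if_False)
  qed
qed

theorem theorem3p2: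
  fixes r k n :: nat
  assumes "r \<ge> 2" and "k \<ge> 1" and "n \<ge> r * k"
  shows "chromatic_number
           (compatibility_graph (integer_mod_group r)
              (cyclic_shift r (kneser_graph n k)) (hom_poset r (kneser_graph n k)))
         \<ge> n - r * (k - 1)"
proof -
  let ?H = "kneser_graph n k"
  let ?C = "compatibility_graph (integer_mod_group r) (cyclic_shift r ?H) (hom_poset r ?H)"
  \<comment> \<open>The \<open>r\<close> demands of \<open>k\<close> sum to \<open>r * k\<close>,
    leaving acyclicity up to \<open>n - r * k\<close>.\<close>
  define P where "P = partial_colourings {1..n} {1..r} (\<lambda>_. k) Map.empty"
  define E where "E = kneser_tuple n k r"
  interpret cyclic_action P map_comparable "rotate_colours r" r
    unfolding P_def by (rule cyclic_action_rotate_colours[OF assms(1)]) simp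
  have r1: "r \<ge> 1" using assms(1) by simp
  have E: "E x \<in> carrier (hom_poset r ?H)" if "x \<in> P" for x
    using that unfolding P_def E_def by (rule kneser_tuple_in_hom_poset)
  have E_pow: "E ((rotate_colours r ^^ i) x) = cyclic_shift r ?H (int i mod int r) (E x)"
    if x: "x \<in> P" for x i
  proof (induction i)
    case 0
    then show ?case by (simp add: cyclic_shift_0[OF E[OF x]])
  next
    case (Suc i)
    have "E ((rotate_colours r ^^ Suc i) x)
        = cyclic_shift r ?H 1 (E ((rotate_colours r ^^ i) x))"
      using kneser_tuple_rotate_colours[OF r1] funpow_closed[OF x, of i] by (simp add: E_def P_def)
    also have "\<dots> = cyclic_shift r ?H ((1 + int i mod int r) mod int r) (E x)"
      unfolding Suc by (rule cyclic_shift_add[OF r1 E[OF x]])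
    also have "(1 + int i mod int r) mod int r = int (Suc i) mod int r" by (simp add: mod_simps)
    finally show ?case .
  qed
  have "pair_graph ?C"
    by (rule pair_graph_compatibility_graph_hom_poset[OF r1 pair_graph_kneser_graph[OF assms(2)]])
  then have "\<exists>c f. proper_colouring ?C c f"
    by (intro ex_proper_colouring) (simp add: pair_graph_def)
  then obtain f where f: "proper_colouring ?C (chromatic_number ?C) f"
    unfolding chromatic_number_def using LeastI_ex[of "\<lambda>c. \<exists>f. proper_colouring ?C c f"] by blast
  have "(n - r * k) + r \<le> chromatic_number ?C"
  proof (rule compatibility_colouring_bound[OF reflp_map_comparable, where c = "f \<circ> E"])
    show "acyclic_upto P map_comparable (n - r * k) P"
      unfolding P_def by (rule acyclic_upto_partial_colourings)
        (use assms(3) in \<open>auto intro: finite_partial_colourings\<close>)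
    show "(f \<circ> E) x < chromatic_number ?C" if "x \<in> P" for x
      using f E[OF that] by (auto simp: proper_colouring_def compatibility_graph_def)
  next
    \<comment> \<open>Comparability of \<open>x\<close> with a proper translate of \<open>y\<close>
      passes through \<open>E\<close> to an edge of the compatibility graph, so
      \<open>f \<circ> E\<close> satisfies the properness condition.\<close>
    fix x y i assume xy: "x \<in> P" "y \<in> P" and i: "0 < i" "i < r"
      and "map_comparable x ((rotate_colours r ^^ i) y)"
    then have "E x \<sqsubseteq>\<^bsub>hom_poset r ?H\<^esub> E ((rotate_colours r ^^ i) y) \<or>
        E ((rotate_colours r ^^ i) y) \<sqsubseteq>\<^bsub>hom_poset r ?H\<^esub> E x"
      unfolding map_comparable_def E_def using kneser_tuple_mono by blast
    then have "E x \<sqsubseteq>\<^bsub>hom_poset r ?H\<^esub> cyclic_shift r ?H (int i) (E y) \<or>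
        cyclic_shift r ?H (int i) (E y) \<sqsubseteq>\<^bsub>hom_poset r ?H\<^esub> E x"
      using i by (simp add: E_pow[OF xy(2)])
    moreover have "int i \<in> carrier (integer_mod_group r) - {\<one>\<^bsub>integer_mod_group r\<^esub>}"
      using i by (simp add: carrier_integer_mod_group)
    ultimately have "(E x, E y) \<in> parcs ?C"
      using E xy unfolding compatibility_graph_def by auto
    then show "(f \<circ> E) x \<noteq> (f \<circ> E) y" using f by (auto simp: proper_colouring_def)
  qed
  \<comment> \<open>With \<open>k \<ge> 1\<close> and \<open>n \<ge> r * k\<close> the truncated
    subtractions agree with those of integers.\<close>
  moreover have "n - r * (k - 1) = (n - r * k) + r"
  proof -
    have "r \<le> r * k" using assms(2) by simp
    then show ?thesis using assms(3) by (simp add: diff_mult_distrib2)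
  qed
  ultimately show ?thesis by simp
qed

end
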